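(* Let $N\ge1$ be an integer, let $q\in(-1,\infty)$, and put $t=q/(1+q)<1$. (1) The maximum of $\sum_{n=1}^N P_t(x_1,\ldots,x_n)\big/\sum_{n=1}^N x_n$, after the normalization $\sum_{k=1}^N x_k=1$, is attained at a unique point of the open simplex $\{x: x_k>0,\ \sum_{k=1}^N x_k=1\}$. (Removing the normalization, the positive extremal vectors form exactly one positive ray.) (2) The number $\lambda_N(q)$ is the unique value $\Lambda>0$ for which the orbit $$y_1=\Lambda,\qquad y_{n+1}=T_{n,q,\Lambda}(y_n)$$ is admissible through $N$ and satisfies $N y_N=1$. (3) The map $(q,\Lambda,y,h)\mapsto T_{h,q,\Lambda}(y)$ (with its value at $q=0$ being the removable continuation given in the context) is locally jointly real analytic, including across $q=0$, whenever $q>-1$, $\Lambda>0$, $h>0$ and $y>h$ (and its complexification is holomorphic on the corresponding local charts).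
   Context: For $t<1$ and $x_1,\ldots,x_n>0$ the power mean is $P_t(x_1,\ldots,x_n)=\left(\frac1n\sum_{k=1}^n x_k^t\right)^{1/t}$ if $t\ne0$, and $P_0(x_1,\ldots,x_n)=(x_1\cdots x_n)^{1/n}$. The finite Hardy constant is $$\Lambda_N(t)=\sup_{x_1,\ldots,x_N>0}\frac{\sum_{n=1}^N P_t(x_1,\ldots,x_n)}{\sum_{n=1}^N x_n},$$ and for $q\in(-1,\infty)$ one writes $\lambda_N(q)=\Lambda_N\!\left(\frac{q}{1+q}\right)$. For $h>0$, $q>-1$, $\Lambda>0$ and $y>h$ define, for $q\neq0$, $$T_{h,q,\Lambda}(y)=(y-h)\left[\frac{1+h}{1+h\left((y-h)/\Lambda\right)^q}\right]^{1/q},$$ and, for $q=0$, $T_{h,0,\Lambda}(y)=(y-h)^{1/(1+h)}\Lambda^{h/(1+h)}$. For an integer $n\ge1$, $T_{n,q,\Lambda}$ denotes this map with $h=h_n=1/n$; in particular $T_{n,0,\Lambda}(y)=(y-1/n)^{n/(n+1)}\Lambda^{1/(n+1)}$. The domain of $T_{n,q,\Lambda}$ is $(1/n,\infty)$. An orbit $y_1,\ldots,y_N$ is called admissible through $N$ if $y_n>1/n$ for all $1\le n<N$ (the value $y_N=1/N$ is allowed at the end). *)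

theory Defs
  imports "HOL-Analysis.Analysis"
begin

text \<open>A vector $(x_1,\ldots,x_N)$ is a function on \<open>nat\<close> that is \<open>undefined\<close> outside \<open>{1..N}\<close>, so
  that equality of functions is equality of vectors and the prefixes $(x_1,\ldots,x_n)$ with
  $n \le N$ are read off from the same function.\<close>

definition power_mean :: "real \<Rightarrow> nat \<Rightarrow> (nat \<Rightarrow> real) \<Rightarrow> real" where
  "power_mean t n x =
     (if t = 0 then (\<Prod>k=1..n. x k) powr (1 / real n)
      else ((1 / real n) * (\<Sum>k=1..n. x k powr t)) powr (1 / t))"

definition hardy_ratio :: "real \<Rightarrow> nat \<Rightarrow> (nat \<Rightarrow> real) \<Rightarrow> real" where
  "hardy_ratio t N x = (\<Sum>n=1..N. power_mean t n x) / (\<Sum>n=1..N. x n)"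

definition positive_vectors :: "nat \<Rightarrow> (nat \<Rightarrow> real) set" where
  "positive_vectors N = ({1..N} \<rightarrow>\<^sub>E {0<..})"

definition open_simplex :: "nat \<Rightarrow> (nat \<Rightarrow> real) set" where
  "open_simplex N = {x \<in> positive_vectors N. (\<Sum>k=1..N. x k) = 1}"

definition positive_ray :: "nat \<Rightarrow> (nat \<Rightarrow> real) \<Rightarrow> (nat \<Rightarrow> real) set" where
  "positive_ray N x = {(\<lambda>k\<in>{1..N}. c * x k) | c. c > 0}"

definition finite_hardy_constant :: "nat \<Rightarrow> real \<Rightarrow> real" where
  "finite_hardy_constant N t = (SUP x\<in>positive_vectors N. hardy_ratio t N x)"

definition hardy_lambda :: "nat \<Rightarrow> real \<Rightarrow> real" where
  "hardy_lambda N q = finite_hardy_constant N (q / (1 + q))"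

text \<open>Stated for \<open>real\<close> and \<open>complex\<close> at once: over \<open>complex\<close>, where \<open>powr\<close> uses the principal
  branch of the logarithm, it is the complexification of the real map.\<close>

definition T_map :: "'a \<Rightarrow> 'a \<Rightarrow> 'a \<Rightarrow> 'a \<Rightarrow> 'a::{real_normed_field, ln}" where
  "T_map h q \<Lambda> y =
     (if q = 0 then (y - h) powr (1 / (1 + h)) * \<Lambda> powr (h / (1 + h))
      else (y - h) * ((1 + h) / (1 + h * ((y - h) / \<Lambda>) powr q)) powr (1 / q))"

text \<open>The orbit starts at index 1; its value at index 0 is a dummy.\<close>

primrec T_orbit :: "real \<Rightarrow> real \<Rightarrow> nat \<Rightarrow> real" where
  "T_orbit q \<Lambda> 0 = \<Lambda>"
| "T_orbit q \<Lambda> (Suc n) = (if n = 0 then \<Lambda> else T_map (1 / real n) q \<Lambda> (T_orbit q \<Lambda> n))"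

definition admissible_through :: "nat \<Rightarrow> (nat \<Rightarrow> real) \<Rightarrow> bool" where
  "admissible_through N y \<longleftrightarrow> (\<forall>n. 1 \<le> n \<and> n < N \<longrightarrow> y n > 1 / real n)"

text \<open>Joint real analyticity: expansion into an (absolutely) convergent multivariate power series
  on a cube around the point; \<open>\<alpha>\<close> ranges over multi-indices.\<close>

definition real_analytic_at :: "(real ^ 'n \<Rightarrow> real) \<Rightarrow> real ^ 'n \<Rightarrow> bool" where
  "real_analytic_at f p \<longleftrightarrow>
     (\<exists>r>0. \<exists>a :: ('n \<Rightarrow> nat) \<Rightarrow> real. \<forall>x. (\<forall>i. \<bar>x $ i - p $ i\<bar> < r) \<longrightarrow>
        ((\<lambda>\<alpha>. a \<alpha> * (\<Prod>i\<in>UNIV. (x $ i - p $ i) ^ \<alpha> i)) has_sum f x) UNIV)"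

text \<open>Holomorphy in several variables on an open set: the derivative exists and is complex linear.\<close>

definition jointly_holomorphic_on :: "(complex ^ 'n \<Rightarrow> complex) \<Rightarrow> (complex ^ 'n) set \<Rightarrow> bool" where
  "jointly_holomorphic_on f U \<longleftrightarrow>
     open U \<and> (\<forall>z\<in>U. \<exists>d :: complex ^ 'n. (f has_derivative (\<lambda>v. \<Sum>i\<in>UNIV. d $ i * v $ i)) (at z))"

definition complex_point :: "real ^ 'n \<Rightarrow> complex ^ 'n" where
  "complex_point p = (\<chi> i. complex_of_real (p $ i))"

text \<open>The coordinates 1, 2, 3, 4 are $q$, $\Lambda$, $y$, $h$.\<close>

definition T_joint :: "'a ^ 4 \<Rightarrow> 'a::{real_normed_field, ln}" where
  "T_joint p = T_map (p $ 4) (p $ 1) (p $ 2) (p $ 3)"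

definition T_domain :: "(real ^ 4) set" where
  "T_domain = {p. p $ 1 > -1 \<and> p $ 2 > 0 \<and> p $ 4 > 0 \<and> p $ 3 > p $ 4}"

end

theory Submission
  imports Defs "HOL-Complex_Analysis.Cauchy_Integral_Formula"
begin

text \<open>
  Write \<open>s = 1 - t = 1 / (1 + q)\<close> and \<open>P\<^sub>n = P\<^sub>t(x\<^sub>1, \<dots>, x\<^sub>n)\<close>. Each \<open>P\<^sub>n\<close> is concave and homogeneous of
  degree one, so it lies below its tangent functional at any positive vector \<open>x\<close>, and it meets the
  tangent exactly on the ray of \<open>x\<close> (\<open>power_mean_le_tangent\<close>). The coefficient of \<open>z\<^sub>k\<close> in the sum of
  these tangents over \<open>n \<le> N\<close> is \<open>x\<^sub>k\<close> to the power \<open>-s\<close> times the sum of \<open>P\<^sub>n\<^sup>s / n\<close> over \<open>n \<ge> k\<close>. If all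
  these coefficients have one common value \<open>\<Lambda>\<close>, which is Lagrange's condition (\<open>critical_vector\<close>), the
  summed inequality says that the Hardy ratio is at most \<open>\<Lambda>\<close>, with equality exactly on the ray of \<open>x\<close>
  (\<open>hardy_ratio_le_critical\<close>). Thus one critical vector gives existence and uniqueness of the maximizer
  together with the value of the Hardy constant.

  Subtracting consecutive equations of the critical system and putting \<open>y\<^sub>n = \<Lambda> (x\<^sub>n / P\<^sub>n)\<^sup>s\<close> gives
  \<open>y\<^sub>n - 1/n = \<Lambda> (x\<^sub>n\<^sub>+\<^sub>1 / P\<^sub>n)\<^sup>s\<close>; the definition of the power mean turns this into
  \<open>y\<^sub>n\<^sub>+\<^sub>1 = T(y\<^sub>n)\<close>, and the last equation reads \<open>N y\<^sub>N = 1\<close>. Conversely the orbit determines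
  the ratios \<open>P\<^sub>n\<^sub>+\<^sub>1 / P\<^sub>n\<close> and \<open>x\<^sub>n / P\<^sub>n\<close>, so every admissible orbit with \<open>N y\<^sub>N = 1\<close> comes from a critical
  vector (\<open>critical_vector_orbit_vector\<close>). In particular all such parameters \<open>\<Lambda>\<close> equal the Hardy constant.

  That there is such a \<open>\<Lambda>\<close> is shown by induction on \<open>N\<close> (\<open>orbit_root_exists\<close>). If \<open>L\<close> is the root for \<open>N\<close>,
  then \<open>y\<^sub>N\<^sub>+\<^sub>1\<close> is continuous in \<open>\<Lambda>\<close> on \<open>(L, \<infinity>)\<close>. It is asymptotic to \<open>\<Lambda>\<close> at infinity, and
  its limit at \<open>L\<close> is below \<open>1 / (N + 1)\<close>: the limit is \<open>0\<close> for \<open>q \<ge> 0\<close> and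
  \<open>L * (N + 1) powr (1 / q)\<close> for \<open>q < 0\<close>, where the crude bound \<open>critical_value_le\<close> on \<open>L\<close> is strong
  enough. The intermediate value theorem gives the next root.

  For the analyticity, put \<open>a = h / (1 + h)\<close> and \<open>u = ln (y - h) - ln \<Lambda>\<close>. With the entire function
  \<open>E(w) = (e\<^sup>w - 1) / w\<close> and the function \<open>\<ell>(z) = ln (1 + z) / z\<close>, both continued to \<open>0\<close>, the map
  is \<open>(y - h) exp (- a u E(q u) \<ell>(a (exp (q u) - 1)))\<close> (\<open>T_joint_eq_T_regular\<close>), where no division by \<open>q\<close>
  is left. Sums, products and compositions with holomorphic functions of one variable preserve both
  the complex differentiability and the expansion into an absolutely convergent multivariate power
  series (\<open>majorized_at_compose\<close>); real parts of the coefficients then give the real expansion.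
\<close>

section \<open>Power means and their tangents\<close>

text \<open>The Box-Cox transform. It treats \<open>t = 0\<close> and \<open>t \<noteq> 0\<close> alike: by \<open>power_mean_eq_iff\<close> the power mean of
  \<open>x\<close> is the number \<open>m\<close> at which the transforms of the ratios \<open>x k / m\<close> sum to zero.\<close>

definition box_cox :: "real \<Rightarrow> real \<Rightarrow> real" where
  "box_cox t u = (if t = 0 then ln u else (u powr t - 1) / t)"

lemma box_cox_mult:
  assumes "u > 0" "v > 0"
  shows "box_cox t (u * v) = v powr t * box_cox t u + box_cox t v"
  using assms by (auto simp: box_cox_def ln_mult powr_mult field_simps)

lemma box_cox_has_derivative:
  assumes "v > 0"
  shows "(box_cox t has_real_derivative v powr (t - 1)) (at v)"
proof (cases "t = 0")
  case True
  then have "box_cox t = ln" by (auto simp: box_cox_def)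
  then show ?thesis using assms True
    by (auto intro!: derivative_eq_intros simp: powr_minus divide_inverse)
next
  case False
  then have "box_cox t = (\<lambda>u. (u powr t - 1) / t)" by (auto simp: box_cox_def)
  then show ?thesis using assms False by (auto intro!: derivative_eq_intros)
qed

text \<open>The difference of the two sides has derivative \<open>1 - v powr (t - 1)\<close>, which changes sign at
  \<open>1\<close> because \<open>t < 1\<close>; so \<open>1\<close> is its strict minimum.\<close>

lemma box_cox_less_tangent_at_1:
  assumes "t < 1" "u > 0" "u \<noteq> 1"
  shows "box_cox t u < u - 1"
proof -
  define f where "f v = v - 1 - box_cox t v" for v :: real
  \<comment> \<open>f is the gap between the two sides and vanishes at 1.\<close>
  have der: "(f has_real_derivative 1 - v powr (t - 1)) (at v)" if "v > 0" for v
    unfolding f_def using that by (auto intro!: derivative_eq_intros box_cox_has_derivative)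
  have cont: "continuous_on {a..b} f" if "a > 0" for a b
  proof (intro continuous_at_imp_continuous_on ballI)
    fix v assume "v \<in> {a..b}"
    then have "v > 0" using that by simp
    from der[OF this] show "isCont f v" by (rule DERIV_isCont)
  qed
  have "f 1 < f u"
  proof (cases "u > 1")
    case True
    have "v powr (t - 1) < 1" if "1 < v" for v
      using that assms(1) by (intro powr_less_one) auto
    then have "\<exists>y. DERIV f v :> y \<and> y > 0" if "1 < v" for v
      using that der[of v] by (intro exI[of _ "1 - v powr (t - 1)"]) auto
    then show ?thesis
      by (intro DERIV_pos_imp_increasing_open[OF True] cont) auto
  next
    case False
    then have u: "u < 1" using assms by simp
    have "1 < v powr (t - 1)" if "0 < v" "v < 1" for v
      using powr_less_mono2_neg[of "t - 1" v 1] that assms(1) by simp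
    then have "\<exists>y. DERIV f v :> y \<and> y < 0" if "0 < v" "v < 1" for v
      using that der[of v] by (intro exI[of _ "1 - v powr (t - 1)"]) auto
    then show ?thesis
      using assms(2) by (intro DERIV_neg_imp_decreasing_open[OF u] cont) auto
  qed
  moreover have "f 1 = 0" by (simp add: f_def box_cox_def)
  ultimately show ?thesis by (simp add: f_def)
qed

text \<open>Strict concavity at an arbitrary point, moved to the point \<open>1\<close> by \<open>box_cox_mult\<close>.\<close>

lemma box_cox_less_tangent:
  assumes "t < 1" "v > 0" "w > 0" "w \<noteq> v"
  shows "box_cox t w < box_cox t v + v powr (t - 1) * (w - v)"
proof -
  have "box_cox t w = v powr t * box_cox t (w / v) + box_cox t v"
    using box_cox_mult[of "w / v" v t] assms by simp
  also have "\<dots> < v powr t * (w / v - 1) + box_cox t v"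
    using box_cox_less_tangent_at_1[of t "w / v"] assms by simp
  also have "v powr t * (w / v - 1) = v powr (t - 1) * (w - v)"
    using assms by (simp add: powr_diff field_simps)
  finally show ?thesis by simp
qed

lemma box_cox_le_tangent:
  assumes "t < 1" "v > 0" "w > 0"
  shows "box_cox t w \<le> box_cox t v + v powr (t - 1) * (w - v)"
  using box_cox_less_tangent[OF assms] by (cases "w = v") auto

lemma power_mean_pos:
  assumes "n \<ge> 1" "\<And>k. k \<in> {1..n} \<Longrightarrow> x k > 0"
  shows "power_mean t n x > 0"
proof -
  have "(\<Sum>k=1..n. x k powr t) > 0"
    using assms by (intro sum_pos) (auto simp: less_imp_neq[symmetric])
  then show ?thesis
    unfolding power_mean_def using assms by (auto simp: prod_zero_iff) (metis assms(2) atLeastAtMost_iff less_irrefl One_nat_def)+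
qed

lemma power_mean_eq_iff:
  assumes n: "n \<ge> 1" and x: "\<And>k. k \<in> {1..n} \<Longrightarrow> x k > 0" and m: "m > 0"
  shows "power_mean t n x = m \<longleftrightarrow> (\<Sum>k=1..n. box_cox t (x k / m)) = 0"
proof (cases "t = 0")
  case True
  define p where "p = (\<Prod>k=1..n. x k)"
  have p: "p > 0" unfolding p_def using x by (intro prod_pos) auto
  have "(\<Sum>k=1..n. box_cox t (x k / m)) = (\<Sum>k=1..n. ln (x k) - ln m)"
    using x m True by (intro sum.cong refl) (auto simp: box_cox_def ln_div less_imp_neq[symmetric])
  also have "\<dots> = ln p - n * ln m"
    using x ln_prod[of "{1..n}" x] by (simp add: sum_subtractf p_def less_imp_neq[symmetric])
  finally have "(\<Sum>k=1..n. box_cox t (x k / m)) = 0 \<longleftrightarrow> ln p / n = ln m"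
    using n by (auto simp: field_simps)
  also have "\<dots> \<longleftrightarrow> ln (p powr (1 / n)) = ln m" by simp
  also have "\<dots> \<longleftrightarrow> p powr (1 / n) = m" using p m by (subst ln_inj_iff) auto
  finally show ?thesis using True by (simp add: power_mean_def p_def)
next
  case False
  define s where "s = (\<Sum>k=1..n. x k powr t)"
  have s: "s > 0" unfolding s_def using x n by (intro sum_pos) (auto simp: less_imp_neq[symmetric])
  have "(\<Sum>k=1..n. box_cox t (x k / m)) = (\<Sum>k=1..n. x k powr t / m powr t - 1) / t"
    unfolding sum_divide_distrib
    using x m False by (intro sum.cong refl) (auto simp: box_cox_def powr_divide less_imp_le)
  also have "(\<Sum>k=1..n. x k powr t / m powr t - 1) = s / m powr t - n"
    by (simp add: sum_subtractf s_def sum_divide_distrib)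
  finally have "(\<Sum>k=1..n. box_cox t (x k / m)) = 0 \<longleftrightarrow> s / n = m powr t"
    using n m False by (auto simp: field_simps)
  also have "\<dots> \<longleftrightarrow> (s / n) powr (1 / t) = m"
  proof
    assume "s / n = m powr t"
    then show "(s / n) powr (1 / t) = m" using m False by (simp add: powr_powr)
  next
    assume "(s / n) powr (1 / t) = m"
    then have "m powr t = ((s / n) powr (1 / t)) powr t" by simp
    then show "s / n = m powr t" using s n False by (simp add: powr_powr)
  qed
  finally show ?thesis using False by (simp add: power_mean_def s_def)
qed

lemma sum_box_cox_power_mean:
  assumes "n \<ge> 1" "\<And>k. k \<in> {1..n} \<Longrightarrow> x k > 0"
  shows "(\<Sum>k=1..n. box_cox t (x k / power_mean t n x)) = 0"
  using power_mean_eq_iff[where t = t and x = x, OF assms power_mean_pos[where t = t and x = x, OF assms]] by blast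

text \<open>For \<open>t \<noteq> 0\<close> this is \<open>sum_box_cox_power_mean\<close> rewritten. It is the normalization that makes the tangent
  functional of the power mean at \<open>x\<close> take the right value at \<open>x\<close> itself.\<close>

lemma sum_powr_power_mean:
  assumes "n \<ge> 1" "\<And>k. k \<in> {1..n} \<Longrightarrow> x k > 0"
  shows "(\<Sum>k=1..n. (x k / power_mean t n x) powr t) = n"
proof -
  define P where "P = power_mean t n x"
  have P: "P > 0" unfolding P_def by (rule power_mean_pos[OF assms])
  show ?thesis unfolding P_def[symmetric]
  proof (cases "t = 0")
    case True
    have "(\<Sum>k=1..n. (x k / P) powr t) = (\<Sum>k=1..n. 1)"
      by (intro sum.cong) (use True P assms(2) in \<open>auto simp: less_imp_neq[symmetric]\<close>)
    then show "(\<Sum>k=1..n. (x k / P) powr t) = n" by simp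
  next
    case False
    have "(\<Sum>k=1..n. (x k / P) powr t - 1) / t = (\<Sum>k=1..n. box_cox t (x k / P))"
      using False by (simp add: box_cox_def sum_divide_distrib)
    also have "\<dots> = 0" unfolding P_def by (rule sum_box_cox_power_mean[OF assms])
    finally show "(\<Sum>k=1..n. (x k / P) powr t) = n" using False by (simp add: sum_subtractf)
  qed
qed

lemma power_mean_scale:
  assumes n: "n \<ge> 1" and x: "\<And>k. k \<in> {1..n} \<Longrightarrow> x k > 0" and c: "c > 0"
    and z: "\<And>k. k \<in> {1..n} \<Longrightarrow> z k = c * x k"
  shows "power_mean t n z = c * power_mean t n x"
proof -
  have "(\<Sum>k=1..n. box_cox t (z k / (c * power_mean t n x))) = (\<Sum>k=1..n. box_cox t (x k / power_mean t n x))"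
    using z c by (intro sum.cong) auto
  then show ?thesis
    using power_mean_eq_iff[OF n, of z "c * power_mean t n x" t] x z c power_mean_pos[where t = t, OF n x]
      sum_box_cox_power_mean[where t = t, OF n x] by simp
qed

text \<open>With \<open>Q\<close> the power mean of \<open>z\<close>, the concavity of the Box-Cox transform at \<open>x k / P\<close>, evaluated at
  \<open>z k / Q\<close> and summed over \<open>k\<close>, reads \<open>0 \<le> n * B / Q - n\<close>, since both sums of transforms vanish.
  Strict concavity forces \<open>z k / Q = x k / P\<close> in the case of equality.\<close>

lemma power_mean_le_tangent:
  assumes t: "t < 1" and n: "n \<ge> 1"
    and x: "\<And>k. k \<in> {1..n} \<Longrightarrow> x k > 0" and z: "\<And>k. k \<in> {1..n} \<Longrightarrow> z k > 0"
  defines "P \<equiv> power_mean t n x"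
  defines "B \<equiv> (\<Sum>k=1..n. (x k / P) powr (t - 1) * z k) / n"
  shows "power_mean t n z \<le> B"
    and "power_mean t n z = B \<longleftrightarrow> (\<exists>c>0. \<forall>k\<in>{1..n}. z k = c * x k)"
proof -
  define Q where "Q = power_mean t n z"
  have P: "P > 0" unfolding P_def by (rule power_mean_pos[OF n x])
  have Q: "Q > 0" unfolding Q_def by (rule power_mean_pos[OF n z])
  let ?v = "\<lambda>k. x k / P" and ?w = "\<lambda>k. z k / Q"
  let ?T = "\<lambda>k. box_cox t (?v k) + ?v k powr (t - 1) * (?w k - ?v k)"
  have "?v k powr (t - 1) * (?w k - ?v k) = ?v k powr (t - 1) * z k / Q - ?v k powr t"
    if "k \<in> {1..n}" for k
    using x[OF that] P Q by (simp add: powr_diff field_simps)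
  then have "(\<Sum>k=1..n. ?T k) = 0 + (\<Sum>k=1..n. ?v k powr (t - 1) * z k / Q - ?v k powr t)"
    using sum_box_cox_power_mean[where t = t, OF n x] by (simp add: sum.distrib P_def)
  also have "\<dots> = n * B / Q - n"
    using sum_powr_power_mean[where t = t, OF n x] n
    by (simp add: sum_subtractf P_def B_def sum_divide_distrib[symmetric])
  finally have T: "(\<Sum>k=1..n. ?T k) = n * B / Q - n" .
  have W: "(\<Sum>k=1..n. box_cox t (?w k)) = 0"
    unfolding Q_def by (rule sum_box_cox_power_mean[OF n z])
  have le: "box_cox t (?w k) \<le> ?T k" if "k \<in> {1..n}" for k
    using that x z P Q by (intro box_cox_le_tangent t) auto
  have "0 \<le> n * B / Q - n" using sum_mono[of "{1..n}" "\<lambda>k. box_cox t (?w k)" ?T] le T W by simp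
  then show QB: "power_mean t n z \<le> B" using Q n by (simp add: Q_def[symmetric] field_simps)
  show "power_mean t n z = B \<longleftrightarrow> (\<exists>c>0. \<forall>k\<in>{1..n}. z k = c * x k)"
  proof
    assume "power_mean t n z = B"
    then have "(\<Sum>k=1..n. ?T k) = 0" using T Q by (simp add: Q_def[symmetric])
    have "?w k = ?v k" if k: "k \<in> {1..n}" for k
    proof (rule ccontr)
      assume "?w k \<noteq> ?v k"
      then have "box_cox t (?w k) < ?T k" using k x z P Q by (intro box_cox_less_tangent t) auto
      then have "(\<Sum>k=1..n. box_cox t (?w k)) < (\<Sum>k=1..n. ?T k)"
        using k le by (intro sum_strict_mono_ex1) auto
      then show False using W \<open>(\<Sum>k=1..n. ?T k) = 0\<close> by simp
    qed
    then show "\<exists>c>0. \<forall>k\<in>{1..n}. z k = c * x k"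
      using P Q by (intro exI[of _ "Q / P"]) (auto simp: field_simps)
  next
    assume "\<exists>c>0. \<forall>k\<in>{1..n}. z k = c * x k"
    then obtain c where c: "c > 0" "\<And>k. k \<in> {1..n} \<Longrightarrow> z k = c * x k" by blast
    have "(\<Sum>k=1..n. ?v k powr (t - 1) * z k) = (\<Sum>k=1..n. c * P * ?v k powr t)"
      using c x P by (intro sum.cong refl) (auto simp: powr_diff less_imp_le)
    also have "\<dots> = c * P * n"
      using sum_powr_power_mean[where t = t, OF n x] by (simp add: sum_distrib_left[symmetric] P_def)
    finally have "B = c * P" using n by (simp add: B_def)
    then show "power_mean t n z = B" using power_mean_scale[where t = t, OF n x c] by (simp add: P_def)
  qed
qed

section \<open>Critical vectors and maximizers\<close>

text \<open>Lagrange's condition for the sum of the power means under a constraint on the sum of the entries,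
  cleared of denominators: the partial derivative of the \<open>n\<close>-th power mean in \<open>x k\<close> is
  \<open>power_mean t n x powr (1 - t) / n * x k powr (t - 1)\<close> for \<open>k \<le> n\<close>, and \<open>\<Lambda>\<close> is the multiplier.\<close>

definition critical_vector :: "nat \<Rightarrow> real \<Rightarrow> real \<Rightarrow> (nat \<Rightarrow> real) \<Rightarrow> bool" where
  "critical_vector N t \<Lambda> x \<longleftrightarrow> x \<in> positive_vectors N \<and>
     (\<forall>k\<in>{1..N}. (\<Sum>n=k..N. power_mean t n x powr (1 - t) / n) = \<Lambda> * x k powr (1 - t))"

lemma positive_vectorsD: "x \<in> positive_vectors N \<Longrightarrow> k \<in> {1..N} \<Longrightarrow> x k > 0"
  by (auto simp: positive_vectors_def)

lemma positive_vectors_sum_pos: "x \<in> positive_vectors N \<Longrightarrow> N \<ge> 1 \<Longrightarrow> (\<Sum>k=1..N. x k) > 0"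
  by (intro sum_pos) (auto intro: positive_vectorsD)

text \<open>Interchanging the two sums collects the coefficient of \<open>z k\<close>, and Lagrange's condition says that
  this coefficient is \<open>\<Lambda>\<close>.\<close>

lemma sum_power_mean_tangents:
  assumes x: "critical_vector N t \<Lambda> x"
  shows "(\<Sum>n=1..N. (\<Sum>k=1..n. (x k / power_mean t n x) powr (t - 1) * z k) / n)
           = \<Lambda> * (\<Sum>k=1..N. z k)"
proof -
  define P where "P n = power_mean t n x" for n
  have xpos: "x k > 0" if "k \<in> {1..N}" for k
    using x that by (auto simp: critical_vector_def intro: positive_vectorsD)
  have P: "P n > 0" if "n \<in> {1..N}" for n
    unfolding P_def using that xpos by (intro power_mean_pos) auto
  have "(\<Sum>n=1..N. (\<Sum>k=1..n. (x k / P n) powr (t - 1) * z k) / n)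
      = (\<Sum>n\<in>{1..N}. \<Sum>k\<in>{k \<in> {1..N}. k \<le> n}. (x k / P n) powr (t - 1) * z k / n)"
    unfolding sum_divide_distrib by (intro sum.cong refl) auto
  also have "\<dots> = (\<Sum>k\<in>{1..N}. \<Sum>n\<in>{n \<in> {1..N}. k \<le> n}. (x k / P n) powr (t - 1) * z k / n)"
    by (rule sum.swap_restrict) auto
  also have "\<dots> = (\<Sum>k\<in>{1..N}. \<Lambda> * z k)"
  proof (rule sum.cong[OF refl])
    fix k assume k: "k \<in> {1..N}"
    have "(\<Sum>n\<in>{n \<in> {1..N}. k \<le> n}. (x k / P n) powr (t - 1) * z k / n)
        = (\<Sum>n=k..N. (P n powr (1 - t) / n) * (z k / x k powr (1 - t)))"
    proof (rule sum.cong)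
      fix n assume "n \<in> {k..N}"
      then have "P n > 0" "x k > 0" using k P xpos by auto
      then have "(x k / P n) powr (t - 1) = P n powr (1 - t) / x k powr (1 - t)"
        using powr_minus_divide[of "x k / P n" "1 - t"] by (simp add: powr_divide less_imp_le)
      then show "(x k / P n) powr (t - 1) * z k / n = (P n powr (1 - t) / n) * (z k / x k powr (1 - t))"
        by simp
    qed (use k in auto)
    also have "\<dots> = \<Lambda> * x k powr (1 - t) * (z k / x k powr (1 - t))"
      unfolding sum_distrib_right[symmetric] using x k by (simp add: critical_vector_def P_def)
    also have "\<dots> = \<Lambda> * z k" using xpos[OF k] by simp
    finally show "(\<Sum>n\<in>{n \<in> {1..N}. k \<le> n}. (x k / P n) powr (t - 1) * z k / n) = \<Lambda> * z k" .
  qed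
  finally show ?thesis by (simp add: P_def sum_distrib_left)
qed

text \<open>A critical vector is a global maximizer because every power mean lies below its tangent there; for
  equality it already suffices to look at the power mean of all \<open>N\<close> entries.\<close>

lemma hardy_ratio_le_critical:
  assumes N: "N \<ge> 1" and t: "t < 1" and x: "critical_vector N t \<Lambda> x" and z: "z \<in> positive_vectors N"
  shows "hardy_ratio t N z \<le> \<Lambda>"
    and "hardy_ratio t N z = \<Lambda> \<longleftrightarrow> z \<in> positive_ray N x"
proof -
  let ?B = "\<lambda>n. (\<Sum>k=1..n. (x k / power_mean t n x) powr (t - 1) * z k) / n"
  have xv: "x \<in> positive_vectors N" using x by (simp add: critical_vector_def)
  have le: "power_mean t n z \<le> ?B n"
    and eq: "power_mean t n z = ?B n \<longleftrightarrow> (\<exists>c>0. \<forall>k\<in>{1..n}. z k = c * x k)" if "n \<in> {1..N}" for n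
    using that by (intro power_mean_le_tangent t; auto intro: positive_vectorsD[OF xv] positive_vectorsD[OF z])+
  have S: "(\<Sum>k=1..N. z k) > 0" by (rule positive_vectors_sum_pos[OF z N])
  have sum_le: "(\<Sum>n=1..N. power_mean t n z) \<le> (\<Sum>n=1..N. ?B n)" by (intro sum_mono le)
  then show "hardy_ratio t N z \<le> \<Lambda>"
    using S unfolding sum_power_mean_tangents[OF x] hardy_ratio_def by (simp add: divide_le_eq)
  have "hardy_ratio t N z = \<Lambda> \<longleftrightarrow> (\<Sum>n=1..N. power_mean t n z) = (\<Sum>n=1..N. ?B n)"
    using S unfolding sum_power_mean_tangents[OF x] hardy_ratio_def by (simp add: divide_eq_eq)
  also have "\<dots> \<longleftrightarrow> (\<forall>n\<in>{1..N}. power_mean t n z = ?B n)"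
    using sum_mono_inv[of "\<lambda>n. power_mean t n z" "{1..N}" ?B] le by (auto intro: sum.cong)
  also have "\<dots> \<longleftrightarrow> (\<exists>c>0. \<forall>k\<in>{1..N}. z k = c * x k)"
  proof
    assume "\<forall>n\<in>{1..N}. power_mean t n z = ?B n"
    then show "\<exists>c>0. \<forall>k\<in>{1..N}. z k = c * x k" using eq[of N] N by simp
  next
    assume "\<exists>c>0. \<forall>k\<in>{1..N}. z k = c * x k"
    then obtain c where c: "c > 0" "\<And>k. k \<in> {1..N} \<Longrightarrow> z k = c * x k" by blast
    have "\<exists>c>0. \<forall>k\<in>{1..n}. z k = c * x k" if "n \<in> {1..N}" for n
      using c that by (intro exI[of _ c]) auto
    then show "\<forall>n\<in>{1..N}. power_mean t n z = ?B n" using eq by blast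
  qed
  also have "\<dots> \<longleftrightarrow> z \<in> positive_ray N x"
  proof
    assume "\<exists>c>0. \<forall>k\<in>{1..N}. z k = c * x k"
    then obtain c where c: "c > 0" "\<And>k. k \<in> {1..N} \<Longrightarrow> z k = c * x k" by blast
    have "z = (\<lambda>k\<in>{1..N}. c * x k)"
      using z c by (intro extensionalityI[of _ "{1..N}"]) (auto simp: positive_vectors_def PiE_def)
    then show "z \<in> positive_ray N x" using c by (auto simp: positive_ray_def)
  qed (auto simp: positive_ray_def)
  finally show "hardy_ratio t N z = \<Lambda> \<longleftrightarrow> z \<in> positive_ray N x" .
qed

lemma positive_ray_subset:
  assumes "x \<in> positive_vectors N"
  shows "positive_ray N x \<subseteq> positive_vectors N"
  using positive_vectorsD[OF assms] by (auto simp: positive_ray_def positive_vectors_def)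

lemma self_in_positive_ray: "x \<in> positive_vectors N \<Longrightarrow> x \<in> positive_ray N x"
  unfolding positive_ray_def
  by (auto intro!: exI[of _ 1] simp: positive_vectors_def extensional_restrict PiE_def)

lemma is_arg_max_iff_attains:
  fixes f :: "'a \<Rightarrow> real"
  assumes "\<And>z. z \<in> A \<Longrightarrow> f z \<le> M" "x \<in> A" "f x = M"
  shows "is_arg_max f (\<lambda>z. z \<in> A) z \<longleftrightarrow> z \<in> A \<and> f z = M"
proof
  assume "is_arg_max f (\<lambda>z. z \<in> A) z"
  then have "z \<in> A" "\<not> f x > f z" using assms(2) by (auto simp: is_arg_max_def)
  then show "z \<in> A \<and> f z = M" using assms(1)[of z] assms(3) by simp
next
  assume "z \<in> A \<and> f z = M"
  then show "is_arg_max f (\<lambda>z. z \<in> A) z"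
    using assms(1) by (auto simp: is_arg_max_def not_less)
qed

lemma maximizers_eq_positive_ray:
  assumes "N \<ge> 1" "t < 1" and x: "critical_vector N t \<Lambda> x"
  shows "{z. is_arg_max (hardy_ratio t N) (\<lambda>x. x \<in> positive_vectors N) z} = positive_ray N x"
proof -
  have xv: "x \<in> positive_vectors N" using x by (simp add: critical_vector_def)
  note le = hardy_ratio_le_critical[OF assms]
  have "hardy_ratio t N x = \<Lambda>" using le(2)[OF xv] self_in_positive_ray[OF xv] by simp
  from is_arg_max_iff_attains[of "positive_vectors N" "hardy_ratio t N", OF le(1) xv this]
  show ?thesis using le(2) positive_ray_subset[OF xv] by blast
qed

lemma unique_maximizer_open_simplex:
  assumes N: "N \<ge> 1" and t: "t < 1" and x: "critical_vector N t \<Lambda> x"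
  shows "\<exists>!x. is_arg_max (hardy_ratio t N) (\<lambda>x. x \<in> open_simplex N) x"
proof -
  have xv: "x \<in> positive_vectors N" using x by (simp add: critical_vector_def)
  note le = hardy_ratio_le_critical[OF N t x]
  define S where "S = (\<Sum>k=1..N. x k)"
  have S: "S > 0" unfolding S_def by (rule positive_vectors_sum_pos[OF xv N])
  define e where "e = (\<lambda>k\<in>{1..N}. 1 / S * x k)"
  have er: "e \<in> positive_ray N x" using S unfolding e_def positive_ray_def
    by (intro CollectI exI[of _ "1 / S"]) simp
  have ev: "e \<in> positive_vectors N" using er positive_ray_subset[OF xv] by blast
  have es: "e \<in> open_simplex N"
    using ev S by (simp add: open_simplex_def e_def S_def sum_divide_distrib[symmetric])
  have sub: "z \<in> positive_vectors N" if "z \<in> open_simplex N" for z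
    using that by (simp add: open_simplex_def)
  have "hardy_ratio t N e = \<Lambda>" using le(2)[OF ev] er by simp
  from is_arg_max_iff_attains[of "open_simplex N" "hardy_ratio t N", OF le(1)[OF sub] es this]
  have max: "is_arg_max (hardy_ratio t N) (\<lambda>x. x \<in> open_simplex N) z
      \<longleftrightarrow> z \<in> open_simplex N \<and> z \<in> positive_ray N x" for z
    using le(2)[OF sub] by blast
  have "z = e" if z: "z \<in> open_simplex N" "z \<in> positive_ray N x" for z
  proof -
    obtain c where c: "z = (\<lambda>k\<in>{1..N}. c * x k)" using z(2) by (auto simp: positive_ray_def)
    have "(\<Sum>k=1..N. z k) = 1" using z by (simp add: open_simplex_def)
    then have "c * S = 1" by (simp add: c S_def sum_distrib_left)
    then have "c = 1 / S" using S by (simp add: field_simps)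
    then show ?thesis by (simp add: c e_def)
  qed
  then show ?thesis using max es er by blast
qed

lemma finite_hardy_constant_eq_critical:
  assumes "N \<ge> 1" "t < 1" and x: "critical_vector N t \<Lambda> x"
  shows "finite_hardy_constant N t = \<Lambda>"
proof -
  have xv: "x \<in> positive_vectors N" using x by (simp add: critical_vector_def)
  note le = hardy_ratio_le_critical[OF assms]
  have "hardy_ratio t N x = \<Lambda>" using le(2)[OF xv] self_in_positive_ray[OF xv] by simp
  then show ?thesis unfolding finite_hardy_constant_def
    using xv le(1) by (intro cSup_eq_maximum) auto
qed

section \<open>From orbits to critical vectors\<close>

lemma T_map_pos:
  fixes h q \<Lambda> y :: real
  assumes "h > 0" "\<Lambda> > 0" "y > h"
  shows "T_map h q \<Lambda> y > 0"
proof -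
  have "1 + h * ((y - h) / \<Lambda>) powr q > 0" using assms by (simp add: add_pos_nonneg)
  then show ?thesis using assms by (auto simp: T_map_def)
qed

text \<open>The algebra behind the orbit. If \<open>y\<close> is the orbit value at \<open>n\<close>, then \<open>\<rho>\<close> stands for the quotient of
  the \<open>n\<close>-th by the next power mean, and \<open>w powr (1 + q)\<close> for the next entry divided by the \<open>n\<close>-th power
  mean. The identity says that appending this entry changes the power mean by the factor \<open>1 / \<rho>\<close>.\<close>

lemma T_map_box_cox:
  fixes q \<Lambda> y t :: real and n :: nat
  assumes q: "q > -1" and t: "t = q / (1 + q)" and n: "n \<ge> 1" and \<Lambda>: "\<Lambda> > 0" and y: "y > 1 / n"
  defines "w \<equiv> (y - 1 / n) / \<Lambda>"
  defines "\<rho> \<equiv> (T_map (1 / n) q \<Lambda> y / (y - 1 / n)) powr (1 + q)"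
  shows "(n + 1) * box_cox t \<rho> + \<rho> powr t * box_cox t (w powr (1 + q)) = 0"
proof -
  define d where "d = y - 1 / n"
  have d: "d > 0" using y by (simp add: d_def)
  have w: "w > 0" using d \<Lambda> by (simp add: w_def d_def)
  have dw: "d = \<Lambda> * w" using \<Lambda> by (simp add: w_def d_def)
  show ?thesis
  proof (cases "q = 0")
    case True
    have e: "1 / (1 + 1 / n) = 1 - 1 / real (n + 1)" "(1 / n) / (1 + 1 / n) = 1 / real (n + 1)"
      using n by (auto simp: field_simps)
    have "T_map (1 / n) q \<Lambda> y = d powr (1 - 1 / real (n + 1)) * \<Lambda> powr (1 / real (n + 1))"
      using True unfolding T_map_def d_def e by simp
    then have "ln (T_map (1 / n) q \<Lambda> y) = (1 - 1 / real (n + 1)) * ln d + 1 / real (n + 1) * ln \<Lambda>"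
      using d \<Lambda> by (simp add: ln_mult)
    moreover have "ln \<rho> = ln (T_map (1 / n) q \<Lambda> y) - ln d"
      using True d T_map_pos[of "1 / n" \<Lambda> y q] n \<Lambda> y
      by (simp add: \<rho>_def d_def[symmetric] ln_div)
    ultimately have "ln \<rho> = - (1 / real (n + 1) * (ln d - ln \<Lambda>))"
      by (simp add: algebra_simps diff_divide_distrib)
    also have "ln d - ln \<Lambda> = ln w" using w \<Lambda> by (simp add: dw ln_mult)
    finally have "ln \<rho> = - (ln w / (n + 1))" by simp
    moreover have "\<rho> > 0" "t = 0" using True t d T_map_pos[of "1 / n" \<Lambda> y q] n \<Lambda> y by (auto simp: \<rho>_def d_def)
    ultimately show ?thesis using True w by (simp add: box_cox_def)
  next
    case False
    then have t0: "t \<noteq> 0" using t q by simp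
    have qt: "(1 + q) * t = q" using t q by simp
    define B where "B = (1 + 1 / n) / (1 + (1 / n) * w powr q)"
    have B: "B > 0" unfolding B_def using n by (intro divide_pos_pos add_pos_nonneg) auto
    have T: "T_map (1 / n) q \<Lambda> y = d * B powr (1 / q)"
      using False by (simp add: T_map_def d_def B_def w_def)
    have W: "n + w powr q > 0" using n by (intro add_pos_nonneg) auto
    have "\<rho> powr t = (T_map (1 / n) q \<Lambda> y / d) powr q"
      by (simp add: \<rho>_def d_def powr_powr qt)
    also have "\<dots> = B" using d B False by (simp add: T powr_powr)
    also have "\<dots> = ((n + 1) / n) / ((n + w powr q) / n)" using n by (simp add: B_def add_divide_distrib)
    also have "\<dots> = (n + 1) / (n + w powr q)" using n by simp
    finally have R: "\<rho> powr t = (n + 1) / (n + w powr q)" .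
    have "(n + 1) * (\<rho> powr t - 1) + \<rho> powr t * (w powr q - 1)
        = \<rho> powr t * (n + w powr q) - (n + 1)" by (simp add: algebra_simps)
    also have "\<dots> = 0" using W by (simp add: R)
    finally have "((n + 1) * (\<rho> powr t - 1) + \<rho> powr t * (w powr q - 1)) / t = 0" by simp
    then show ?thesis using t0 by (simp add: box_cox_def powr_powr qt add_divide_distrib)
  qed
qed

text \<open>The values that the power means \<open>P\<^sub>n\<close> of the vector to be constructed must take, in the normalization
  \<open>P\<^sub>1 = 1\<close>: from \<open>y\<^sub>n - 1/n = \<Lambda> (x\<^sub>n\<^sub>+\<^sub>1 / P\<^sub>n)\<^sup>s\<close> and \<open>y\<^sub>n\<^sub>+\<^sub>1 = \<Lambda> (x\<^sub>n\<^sub>+\<^sub>1 / P\<^sub>n\<^sub>+\<^sub>1)\<^sup>s\<close> the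
  quotient \<open>(y\<^sub>n - 1/n) / y\<^sub>n\<^sub>+\<^sub>1\<close> is \<open>(P\<^sub>n\<^sub>+\<^sub>1 / P\<^sub>n)\<^sup>s\<close>, where \<open>s = 1 / (1 + q)\<close>.\<close>

definition orbit_mean :: "real \<Rightarrow> (nat \<Rightarrow> real) \<Rightarrow> nat \<Rightarrow> real" where
  "orbit_mean q y n = (\<Prod>m\<in>{1..<n}. ((y m - 1 / m) / y (Suc m)) powr (1 + q))"

definition orbit_vector :: "nat \<Rightarrow> real \<Rightarrow> real \<Rightarrow> (nat \<Rightarrow> real) \<Rightarrow> nat \<Rightarrow> real" where
  "orbit_vector N q \<Lambda> y = (\<lambda>n\<in>{1..N}. orbit_mean q y n * (y n / \<Lambda>) powr (1 + q))"

lemma orbit_mean_Suc: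
  "n \<ge> 1 \<Longrightarrow> orbit_mean q y (Suc n) = orbit_mean q y n * ((y n - 1 / n) / y (Suc n)) powr (1 + q)"
  by (simp add: orbit_mean_def)

lemma T_orbit_pos:
  assumes "\<Lambda> > 0" "admissible_through N (T_orbit q \<Lambda>)" "1 \<le> n" "n \<le> N"
  shows "T_orbit q \<Lambda> n > 0"
proof (cases "n = 1")
  case False
  then obtain m where "n = Suc m" "m \<ge> 1" using assms(3) by (cases n) auto
  then show ?thesis
    using assms T_map_pos[of "1 / m" \<Lambda> "T_orbit q \<Lambda> m" q] by (simp add: admissible_through_def)
qed (use assms in simp)

lemma orbit_mean_pos:
  assumes "\<Lambda> > 0" "admissible_through N (T_orbit q \<Lambda>)" "n \<le> N"
  shows "orbit_mean q (T_orbit q \<Lambda>) n > 0"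
  unfolding orbit_mean_def
proof (rule prod_pos)
  fix m assume m: "m \<in> {1..<n}"
  have "T_orbit q \<Lambda> (Suc m) > 0" by (rule T_orbit_pos[OF assms(1,2)]) (use m assms in auto)
  moreover have "T_orbit q \<Lambda> m - 1 / m > 0"
    using assms m by (simp add: admissible_through_def)
  ultimately have "(T_orbit q \<Lambda> m - 1 / m) / T_orbit q \<Lambda> (Suc m) > 0" by (rule divide_pos_pos[rotated])
  then have "(T_orbit q \<Lambda> m - 1 / m) / T_orbit q \<Lambda> (Suc m) \<noteq> 0" by linarith
  then show "((T_orbit q \<Lambda> m - 1 / m) / T_orbit q \<Lambda> (Suc m)) powr (1 + q) > 0"
    by (simp del: T_orbit.simps)
qed

text \<open>Induction on \<open>n\<close>: passing from \<open>n\<close> to \<open>Suc n\<close> rescales the old ratios by \<open>\<rho>\<close> and appends one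
  entry, and \<open>T_map_box_cox\<close> says that the new sum of Box-Cox transforms vanishes again.\<close>

lemma power_mean_orbit_vector:
  assumes q: "q > -1" and t: "t = q / (1 + q)" and \<Lambda>: "\<Lambda> > 0"
    and adm: "admissible_through N (T_orbit q \<Lambda>)"
    and n: "1 \<le> n" "n \<le> N"
  shows "power_mean t n (orbit_vector N q \<Lambda> (T_orbit q \<Lambda>)) = orbit_mean q (T_orbit q \<Lambda>) n"
  using n
proof (induction n rule: nat_induct_at_least)
  case base
  define y where "y = T_orbit q \<Lambda>"
  have "orbit_mean q y 1 = 1" by (simp add: orbit_mean_def)
  moreover have "orbit_vector N q \<Lambda> y 1 = 1"
    using base \<Lambda> by (simp add: orbit_vector_def orbit_mean_def y_def)
  ultimately show ?case unfolding y_def[symmetric] by (simp add: power_mean_def)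
next
  case (Suc n)
  define y where "y = T_orbit q \<Lambda>"
  define x where "x = orbit_vector N q \<Lambda> y"
  define P where "P = orbit_mean q y"
  define w where "w = (y n - 1 / n) / \<Lambda>"
  define \<rho> where "\<rho> = (y (Suc n) / (y n - 1 / n)) powr (1 + q)"
  have Ppos: "P k > 0" if "k \<le> N" for k
    unfolding P_def y_def by (rule orbit_mean_pos[OF \<Lambda> adm that])
  have ypos: "y k > 0" if "k \<in> {1..N}" for k
    using T_orbit_pos[OF \<Lambda> adm, of k] that by (simp add: y_def)
  have xpos: "x k > 0" if "k \<in> {1..N}" for k
    using Ppos[of k] ypos[of k] that \<Lambda> by (simp add: x_def orbit_vector_def P_def[symmetric])
  have yn: "y n > 1 / n" using adm Suc by (simp add: admissible_through_def y_def)
  have w: "w > 0" using yn \<Lambda> by (simp add: w_def)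
  have yS: "y (Suc n) = T_map (1 / n) q \<Lambda> (y n)" using Suc by (simp add: y_def)
  have ySp: "y (Suc n) > 0" using ypos Suc by simp
  have \<rho>: "\<rho> > 0" using yn ySp by (simp add: \<rho>_def)
  have "((y n - 1 / n) / y (Suc n)) powr (1 + q) = 1 / \<rho>"
    using yn ySp by (simp add: \<rho>_def powr_divide)
  then have PS: "P (Suc n) = P n / \<rho>" using orbit_mean_Suc[of n q y] Suc by (simp add: P_def)
  have "x (Suc n) = P n / \<rho> * (y (Suc n) / \<Lambda>) powr (1 + q)"
    using Suc by (simp add: x_def orbit_vector_def P_def[symmetric] PS)
  also have "(y (Suc n) / \<Lambda>) powr (1 + q) = \<rho> * w powr (1 + q)"
    using yn ySp \<Lambda> by (simp add: \<rho>_def w_def powr_mult[symmetric])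
  finally have xS: "x (Suc n) / P (Suc n) = w powr (1 + q) * \<rho>"
    using Ppos[of n] Suc \<rho> by (simp add: PS)
  have IH: "power_mean t n x = P n" unfolding x_def P_def y_def using Suc by simp
  have "(\<Sum>k=1..Suc n. box_cox t (x k / P (Suc n)))
      = (\<Sum>k=1..n. box_cox t (x k / P n * \<rho>)) + box_cox t (w powr (1 + q) * \<rho>)"
    using xS by (simp add: PS)
  also have "(\<Sum>k=1..n. box_cox t (x k / P n * \<rho>))
      = (\<Sum>k=1..n. \<rho> powr t * box_cox t (x k / P n) + box_cox t \<rho>)"
    using xpos Ppos[of n] Suc \<rho> by (intro sum.cong refl box_cox_mult) auto
  also have "\<dots> = \<rho> powr t * (\<Sum>k=1..n. box_cox t (x k / P n)) + n * box_cox t \<rho>"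
    by (simp add: sum.distrib sum_distrib_left)
  also have "(\<Sum>k=1..n. box_cox t (x k / P n)) = 0"
    using sum_box_cox_power_mean[where t = t and x = x, of n] xpos Suc by (simp add: IH)
  also have "box_cox t (w powr (1 + q) * \<rho>) = \<rho> powr t * box_cox t (w powr (1 + q)) + box_cox t \<rho>"
    using w \<rho> by (intro box_cox_mult) auto
  also have "\<rho> powr t * 0 + n * box_cox t \<rho> + (\<rho> powr t * box_cox t (w powr (1 + q)) + box_cox t \<rho>) = 0"
    using T_map_box_cox[OF q t _ \<Lambda> yn] Suc by (simp add: yS[symmetric] \<rho>_def w_def algebra_simps)
  finally have "(\<Sum>k=1..Suc n. box_cox t (x k / P (Suc n))) = 0" .
  then show ?case
    using power_mean_eq_iff[where x = x and t = t, of "Suc n" "P (Suc n)"] xpos Ppos[of "Suc n"] Suc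
    unfolding x_def[symmetric] P_def[symmetric] y_def[symmetric] by simp
qed

text \<open>Lagrange's system is solved downwards from \<open>N\<close>. The equation at \<open>N\<close> is the root condition, and the
  difference of the equations at \<open>k\<close> and \<open>Suc k\<close> is the fact \<open>diff\<close> below, which holds by the choice of the
  vector.\<close>

lemma critical_vector_orbit_vector:
  assumes q: "q > -1" and t: "t = q / (1 + q)" and \<Lambda>: "\<Lambda> > 0"
    and adm: "admissible_through N (T_orbit q \<Lambda>)" and root: "real N * T_orbit q \<Lambda> N = 1"
  shows "critical_vector N t \<Lambda> (orbit_vector N q \<Lambda> (T_orbit q \<Lambda>))"
proof -
  define y where "y = T_orbit q \<Lambda>"
  define x where "x = orbit_vector N q \<Lambda> y"
  define P where "P = orbit_mean q y"
  have st: "1 - t = 1 / (1 + q)" using q by (simp add: t field_simps)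
  have Ppos: "P k > 0" if "k \<le> N" for k
    unfolding P_def y_def by (rule orbit_mean_pos[OF \<Lambda> adm that])
  have ypos: "y k > 0" if "k \<in> {1..N}" for k
    using T_orbit_pos[OF \<Lambda> adm, of k] that by (simp add: y_def)
  have xpos: "x k > 0" if "k \<in> {1..N}" for k
    using Ppos[of k] ypos[of k] that \<Lambda> by (simp add: x_def orbit_vector_def P_def[symmetric])
  have xs: "\<Lambda> * x k powr (1 - t) = P k powr (1 - t) * y k" if "k \<in> {1..N}" for k
  proof -
    have "((y k / \<Lambda>) powr (1 + q)) powr (1 - t) = y k / \<Lambda>"
      using ypos[OF that] \<Lambda> q by (simp add: st powr_powr)
    then show ?thesis
      using that \<Lambda> Ppos[of k] by (simp add: x_def orbit_vector_def P_def[symmetric] powr_mult)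
  qed
  have diff: "\<Lambda> * x (Suc k) powr (1 - t) = P k powr (1 - t) * (y k - 1 / k)" if "1 \<le> k" "k < N" for k
  proof -
    have yk: "y k > 1 / k" using adm that by (simp add: admissible_through_def y_def)
    have ySk: "y (Suc k) > 0" using ypos that by simp
    have "P (Suc k) = P k * ((y k - 1 / k) / y (Suc k)) powr (1 + q)"
      unfolding P_def using that by (intro orbit_mean_Suc) auto
    then have "P (Suc k) powr (1 - t) = P k powr (1 - t) * ((y k - 1 / k) / y (Suc k))"
      using Ppos[of k] yk ySk q that by (simp add: powr_mult powr_powr st)
    then show ?thesis using xs[of "Suc k"] that ySk by simp
  qed
  have "(\<Sum>n=k..N. P n powr (1 - t) / n) = \<Lambda> * x k powr (1 - t)" if "1 \<le> k" "k \<le> N" for k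
    using that(2,1)
  proof (induction k rule: inc_induct)
    case base
    have "y N = 1 / N" using root base by (simp add: y_def field_simps)
    then show ?case using xs[of N] base by simp
  next
    case (step k)
    have "(\<Sum>n=k..N. P n powr (1 - t) / n) = P k powr (1 - t) / k + (\<Sum>n=Suc k..N. P n powr (1 - t) / n)"
      using step.hyps by (simp add: sum.atLeast_Suc_atMost)
    also have "\<dots> = P k powr (1 - t) / k + \<Lambda> * x (Suc k) powr (1 - t)" using step by simp
    also have "\<dots> = P k powr (1 - t) * y k"
      using diff[of k] step
      by (simp add: algebra_simps)
    finally show ?case using xs[of k] step by simp
  qed
  moreover have "power_mean t n x = P n" if "1 \<le> n" "n \<le> N" for n
    unfolding x_def P_def y_def by (rule power_mean_orbit_vector[OF q t \<Lambda> adm that])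
  moreover have "x \<in> positive_vectors N"
    using xpos by (auto simp: positive_vectors_def x_def orbit_vector_def)
  ultimately show ?thesis
    unfolding critical_vector_def x_def[symmetric] y_def[symmetric] by simp
qed

section \<open>Existence of the root\<close>

text \<open>This contains the uniqueness of the root: whatever root is given, it is the value of the maximum.\<close>

lemma hardy_lambda_eq_orbit_root:
  assumes "N \<ge> 1" "q > -1" "\<Lambda> > 0" "admissible_through N (T_orbit q \<Lambda>)" "real N * T_orbit q \<Lambda> N = 1"
  shows "hardy_lambda N q = \<Lambda>"
proof -
  have "q / (1 + q) < 1" using assms by simp
  from finite_hardy_constant_eq_critical[OF assms(1) this critical_vector_orbit_vector[OF assms(2) refl assms(3-5)]]
  show ?thesis by (simp add: hardy_lambda_def)
qed

text \<open>For negative \<open>t\<close> one entry alone bounds the mean: dropping all terms of the sum but the last one gives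
  \<open>P\<^sub>n \<le> n powr (- 1 / t) * x n\<close>. The bound is strictly increasing in \<open>N\<close>, which is what the induction step in
  \<open>orbit_root_exists\<close> needs.\<close>

lemma critical_value_le:
  assumes N: "N \<ge> 1" and t: "t < 0" and x: "critical_vector N t \<Lambda> x"
  shows "\<Lambda> \<le> real N powr (- 1 / t)"
proof -
  have xv: "x \<in> positive_vectors N" using x by (simp add: critical_vector_def)
  have "hardy_ratio t N x = \<Lambda>"
    using hardy_ratio_le_critical(2)[OF N _ x xv] t self_in_positive_ray[OF xv] by simp
  have "power_mean t n x \<le> real N powr (- 1 / t) * x n" if n: "n \<in> {1..N}" for n
  proof -
    have xn: "x n > 0" by (rule positive_vectorsD[OF xv n])
    have "x n powr t \<le> (\<Sum>k=1..n. x k powr t)" using n by (intro member_le_sum) auto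
    then have "x n powr t / N \<le> 1 / n * (\<Sum>k=1..n. x k powr t)"
      using n by (auto intro!: frac_le sum_nonneg)
    then have "power_mean t n x \<le> (x n powr t / N) powr (1 / t)"
      unfolding power_mean_def using t xn N by (auto intro!: powr_mono2')
    also have "\<dots> = real N powr (- 1 / t) * x n"
      using xn t by (simp add: powr_divide powr_powr powr_minus_divide)
    finally show ?thesis .
  qed
  then have "(\<Sum>n=1..N. power_mean t n x) \<le> (\<Sum>n=1..N. real N powr (- 1 / t) * x n)" by (rule sum_mono)
  then have "hardy_ratio t N x \<le> real N powr (- 1 / t)"
    using positive_vectors_sum_pos[OF xv N]
    unfolding hardy_ratio_def sum_distrib_left[symmetric] by (simp add: divide_le_eq)
  then show ?thesis using \<open>hardy_ratio t N x = \<Lambda>\<close> by simp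
qed

lemma continuous_on_T_map:
  fixes h q :: real and f g :: "real \<Rightarrow> real"
  assumes "continuous_on S f" "continuous_on S g" "h > 0" "\<And>x. x \<in> S \<Longrightarrow> g x > 0 \<and> f x > h"
  shows "continuous_on S (\<lambda>x. T_map h q (g x) (f x))"
proof -
  have "1 + h * ((f x - h) / g x) powr q > 0" for x
    using assms(3) by (intro add_pos_nonneg) auto
  then have "1 + h * ((f x - h) / g x) powr q \<noteq> 0" for x
    using less_imp_neq[symmetric] by blast
  then show ?thesis
    unfolding T_map_def using assms(3,4)
    by (cases "q = 0") (auto intro!: continuous_intros assms(1,2) simp: less_imp_neq[symmetric])
qed

lemma continuous_on_T_orbit:
  assumes "n \<ge> 1" "\<And>\<Lambda>. \<Lambda> \<in> S \<Longrightarrow> \<Lambda> > 0" "\<And>\<Lambda>. \<Lambda> \<in> S \<Longrightarrow> admissible_through n (T_orbit q \<Lambda>)"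
  shows "continuous_on S (\<lambda>\<Lambda>. T_orbit q \<Lambda> n)"
  using assms(1,3)
proof (induction n rule: nat_induct_at_least)
  case base
  then show ?case by simp
next
  case (Suc n)
  have "continuous_on S (\<lambda>\<Lambda>. T_orbit q \<Lambda> n)"
    using Suc by (intro Suc.IH) (auto simp: admissible_through_def)
  then have "continuous_on S (\<lambda>\<Lambda>. T_map (1 / n) q \<Lambda> (T_orbit q \<Lambda> n))"
    using Suc assms(2) by (intro continuous_on_T_map continuous_intros) (auto simp: admissible_through_def)
  then show ?case using Suc by simp
qed

text \<open>\<open>T\<close> is homogeneous in \<open>\<Lambda>\<close> and \<open>y - h\<close>, so its limits reduce to those of the one-variable function
  \<open>v \<mapsto> T_map h q 1 (h + v)\<close>.\<close>

lemma T_map_scale: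
  fixes h q \<Lambda> y :: real
  assumes "h > 0" "\<Lambda> > 0" "y > h"
  shows "T_map h q \<Lambda> y = \<Lambda> * T_map h q 1 (h + (y - h) / \<Lambda>)"
proof (cases "q = 0")
  case True
  have e: "h / (1 + h) = 1 - 1 / (1 + h)" using assms by (simp add: field_simps)
  show ?thesis using assms True by (simp add: T_map_def e powr_diff powr_divide)
next
  case False
  then show ?thesis using assms by (simp add: T_map_def)
qed

lemma T_map_at_fixed_point:
  fixes h q :: real
  assumes "h > 0"
  shows "T_map h q 1 (h + 1) = 1"
  using assms by (simp add: T_map_def)

text \<open>After division by \<open>\<Lambda>\<close> the subtraction of \<open>1/n\<close> disappears in the limit, and what remains of the map
  fixes \<open>1\<close>.\<close>

lemma T_orbit_ratio_tendsto_1: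
  assumes "n \<ge> 1"
  shows "((\<lambda>\<Lambda>. T_orbit q \<Lambda> n / \<Lambda>) \<longlongrightarrow> 1) at_top"
  using assms
proof (induction n rule: nat_induct_at_least)
  case base
  have "\<forall>\<^sub>F \<Lambda> in at_top. T_orbit q \<Lambda> 1 / \<Lambda> = 1"
    using eventually_gt_at_top[of 0] by eventually_elim simp
  then show ?case by (rule tendsto_eventually)
next
  case (Suc n)
  define h where "h = 1 / real n"
  have h: "h > 0" using Suc by (simp add: h_def)
  define w where "w \<Lambda> = (T_orbit q \<Lambda> n - h) / \<Lambda>" for \<Lambda>
  have "((\<lambda>\<Lambda>. T_orbit q \<Lambda> n / \<Lambda> - h / \<Lambda>) \<longlongrightarrow> 1 - 0) at_top"
    by (intro tendsto_diff Suc.IH tendsto_divide_0[OF tendsto_const] filterlim_at_top_imp_at_infinity filterlim_ident)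
  then have w: "(w \<longlongrightarrow> 1) at_top" by (simp add: w_def[abs_def] diff_divide_distrib)
  have "continuous_on {0<..} (\<lambda>v. T_map h q 1 (h + v))"
    by (intro continuous_on_T_map continuous_intros) (use h in auto)
  then have "isCont (\<lambda>v. T_map h q 1 (h + v)) 1"
    by (simp add: continuous_on_eq_continuous_at)
  from isCont_tendsto_compose[OF this w]
  have lim: "((\<lambda>\<Lambda>. T_map h q 1 (h + w \<Lambda>)) \<longlongrightarrow> 1) at_top"
    using T_map_at_fixed_point[OF h] by simp
  have "\<forall>\<^sub>F \<Lambda> in at_top. w \<Lambda> > 0" using order_tendstoD(1)[OF w, of 0] by simp
  then have "\<forall>\<^sub>F \<Lambda> in at_top. T_map h q 1 (h + w \<Lambda>) = T_orbit q \<Lambda> (Suc n) / \<Lambda>"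
    using eventually_gt_at_top[of 0]
  proof eventually_elim
    case (elim \<Lambda>)
    then have "T_orbit q \<Lambda> n > h" by (simp add: w_def zero_less_divide_iff)
    from T_map_scale[OF h elim(2) this, of q] show ?case
      using elim Suc by (simp add: w_def h_def)
  qed
  from tendsto_cong[OF this] lim show ?case by simp
qed

text \<open>For \<open>q \<noteq> 0\<close> the function is the weighted power mean of \<open>v\<close> and \<open>1\<close> with exponent \<open>- q\<close> and weights
  \<open>1 / (1 + h)\<close> and \<open>h / (1 + h)\<close>. When \<open>v\<close> tends to \<open>0\<close> it therefore keeps a positive limit exactly for
  positive exponent \<open>- q\<close>.\<close>

lemma T_map_tendsto_at_zero:
  fixes h q :: real
  assumes h: "h > 0"
  shows "((\<lambda>v. T_map h q 1 (h + v)) \<longlongrightarrow> (if q < 0 then (h / (1 + h)) powr (- 1 / q) else 0)) (at_right 0)"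
proof -
  have v: "((\<lambda>v. v) \<longlongrightarrow> (0::real)) (at_right 0)" by (rule tendsto_ident_at)
  have nn: "\<forall>\<^sub>F v in at_right (0::real). 0 \<le> v"
    using eventually_at_right_less[of "0::real"] by eventually_elim simp
  consider "q = 0" | "q > 0" | "q < 0" by linarith
  then show ?thesis
  proof cases
    case 1
    have "((\<lambda>v. v powr (1 / (1 + h))) \<longlongrightarrow> 0) (at_right 0)"
      using h by (intro tendsto_zero_powrI[OF v tendsto_const nn]) auto
    then show ?thesis using 1 by (simp add: T_map_def)
  next
    case 2
    have "((\<lambda>v. v powr q) \<longlongrightarrow> 0) (at_right 0)"
      using 2 by (intro tendsto_zero_powrI[OF v tendsto_const nn]) auto
    then have "((\<lambda>v. v * ((1 + h) / (1 + h * v powr q)) powr (1 / q))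
        \<longlongrightarrow> 0 * ((1 + h) / (1 + h * 0)) powr (1 / q)) (at_right 0)"
      using h by (intro tendsto_intros v) auto
    then show ?thesis using 2 by (simp add: T_map_def)
  next
    case 3
    have "((\<lambda>v. v powr (- q)) \<longlongrightarrow> 0) (at_right 0)"
      using 3 by (intro tendsto_zero_powrI[OF v tendsto_const nn]) auto
    then have lim: "((\<lambda>v. ((v powr (- q) + h) / (1 + h)) powr (- 1 / q))
        \<longlongrightarrow> ((0 + h) / (1 + h)) powr (- 1 / q)) (at_right 0)"
      using h by (intro tendsto_intros) auto
    have "\<forall>\<^sub>F v in at_right 0. ((v powr (- q) + h) / (1 + h)) powr (- 1 / q) = T_map h q 1 (h + v)"
      using eventually_at_right_less[of "0::real"]
    proof eventually_elim
      case (elim v)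
      \<comment> \<open>Moving the factor v into the bracket exhibits the weighted power mean, whose exponent is positive.\<close>
      have pos: "v powr (- q) + h > 0" using h by (intro add_nonneg_pos) auto
      have "(1 + h) / (1 + h * v powr q) = v powr (- q) * ((1 + h) / (v powr (- q) + h))"
      proof -
        define V where "V = v powr q"
        have V: "V > 0" using elim by (simp add: V_def)
        then have "1 / V + h = (1 + h * V) / V" by (simp add: field_simps)
        then show ?thesis using V unfolding powr_minus_divide V_def[symmetric] by simp
      qed
      then have "T_map h q 1 (h + v) = v * ((v powr (- q)) powr (1 / q) * ((1 + h) / (v powr (- q) + h)) powr (1 / q))"
        using 3 elim h pos by (simp add: T_map_def powr_mult[symmetric])
      also have "(v powr (- q)) powr (1 / q) = 1 / v" using 3 elim by (simp add: powr_powr powr_neg_one)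
      also have "((1 + h) / (v powr (- q) + h)) powr (1 / q) = ((v powr (- q) + h) / (1 + h)) powr (- 1 / q)"
        using h pos by (simp add: powr_minus_divide powr_divide)
      finally show ?case using elim by simp
    qed
    from tendsto_cong[OF this] lim show ?thesis using 3 by simp
  qed
qed

text \<open>The last clause is carried along to make the induction work: beyond the root for \<open>N\<close> the orbit can be
  continued one step, so \<open>y\<^sub>N\<^sub>+\<^sub>1\<close> is a continuous function there.\<close>

lemma orbit_root_exists:
  fixes q :: real
  assumes q: "q > -1" and N: "N \<ge> 1"
  shows "\<exists>\<Lambda>>0. real N * T_orbit q \<Lambda> N = 1 \<and> admissible_through N (T_orbit q \<Lambda>)
           \<and> (\<forall>\<Lambda>'>\<Lambda>. admissible_through (Suc N) (T_orbit q \<Lambda>'))"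
  using N
proof (induction N rule: nat_induct_at_least)
  case base
  show ?case by (intro exI[of _ 1]) (auto simp: admissible_through_def less_Suc_eq)
next
  case (Suc N)
  then obtain L where L: "L > 0" "real N * T_orbit q L N = 1" "admissible_through N (T_orbit q L)"
    and above: "\<And>\<Lambda>. \<Lambda> > L \<Longrightarrow> admissible_through (Suc N) (T_orbit q \<Lambda>)" by blast
  define h where "h = 1 / real N"
  have h: "h > 0" using Suc by (simp add: h_def)
  define f where "f \<Lambda> = T_orbit q \<Lambda> (Suc N)" for \<Lambda>
  define w where "w \<Lambda> = (T_orbit q \<Lambda> N - h) / \<Lambda>" for \<Lambda>
  have gt: "T_orbit q \<Lambda> N > h" if "\<Lambda> > L" for \<Lambda>
    using above[OF that] Suc by (simp add: admissible_through_def h_def)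
  have f_eq: "f \<Lambda> = \<Lambda> * T_map h q 1 (h + w \<Lambda>)" if "\<Lambda> > L" for \<Lambda>
    using T_map_scale[of h \<Lambda> "T_orbit q \<Lambda> N" q, OF h _ gt[OF that]] that L(1) Suc by (simp add: f_def w_def h_def)
  have f_cont: "continuous_on {L<..} f"
    unfolding f_def using L(1) above by (intro continuous_on_T_orbit) auto
  define m where "m = (if q < 0 then (h / (1 + h)) powr (- 1 / q) else 0)"
  have f_lim: "(f \<longlongrightarrow> L * m) (at_right L)"
  proof -
    have adm: "admissible_through N (T_orbit q \<Lambda>)" if "\<Lambda> \<ge> L" for \<Lambda>
      using that L(3) above[of \<Lambda>] by (cases "\<Lambda> = L") (auto simp: admissible_through_def)
    have "continuous_on {L..} (\<lambda>\<Lambda>. T_orbit q \<Lambda> N)"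
      using L(1) adm Suc by (intro continuous_on_T_orbit) auto
    then have "((\<lambda>\<Lambda>. T_orbit q \<Lambda> N) \<longlongrightarrow> T_orbit q L N) (at L within {L..})"
      by (auto simp: continuous_on_def)
    then have "((\<lambda>\<Lambda>. T_orbit q \<Lambda> N) \<longlongrightarrow> T_orbit q L N) (at_right L)"
      by (rule tendsto_within_subset) auto
    moreover have "T_orbit q L N = h" using L(2) Suc by (simp add: h_def field_simps)
    ultimately have "(w \<longlongrightarrow> (h - h) / L) (at_right L)"
      unfolding w_def using L(1) by (intro tendsto_intros) auto
    moreover have "\<forall>\<^sub>F \<Lambda> in at_right L. w \<Lambda> > 0"
      using eventually_at_right_less[of L] by eventually_elim (use gt L(1) in \<open>auto simp: w_def\<close>)
    ultimately have "filterlim w (at_right 0) (at_right L)"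
      by (simp add: filterlim_at_withinI eventually_mono)
    from filterlim_compose[OF T_map_tendsto_at_zero[OF h, of q] this]
    have "((\<lambda>\<Lambda>. \<Lambda> * T_map h q 1 (h + w \<Lambda>)) \<longlongrightarrow> L * m) (at_right L)"
      unfolding m_def by (intro tendsto_mult tendsto_ident_at)
    moreover have "\<forall>\<^sub>F \<Lambda> in at_right L. \<Lambda> * T_map h q 1 (h + w \<Lambda>) = f \<Lambda>"
      using eventually_at_right_less[of L] by eventually_elim (simp add: f_eq)
    ultimately show ?thesis by (rule Lim_transform_eventually)
  qed
  \<comment> \<open>For negative q this is a genuine restriction on L, met because L is a maximum of Hardy ratios.\<close>
  have below: "L * m < 1 / real (Suc N)"
  proof (cases "q < 0")
    case True
    define t where "t = q / (1 + q)"
    have t: "t < 0" using True q by (simp add: t_def divide_neg_pos)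
    have "L \<le> real N powr (- 1 / t)"
      using critical_value_le[OF _ t critical_vector_orbit_vector[OF q t_def L(1,3,2)]] Suc by simp
    also have "\<dots> < real (Suc N) powr (- 1 / t)"
      using t Suc by (intro powr_less_mono2) (auto simp: divide_pos_neg)
    finally have "L * real (Suc N) powr (1 / q) < real (Suc N) powr (- 1 / t) * real (Suc N) powr (1 / q)"
      by (intro mult_strict_right_mono) auto
    also have "\<dots> = real (Suc N) powr (- 1 / t + 1 / q)" by (rule powr_add[symmetric])
    \<comment> \<open>This cancellation is the reason why the exponent of the crude bound fits: 1 / t = 1 + 1 / q.\<close>
    also have "- 1 / t + 1 / q = - 1" using True q by (simp add: t_def field_simps)
    also have "real (Suc N) powr (- 1) = 1 / real (Suc N)" by (simp add: powr_minus_divide)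
    finally have "L * real (Suc N) powr (1 / q) < 1 / real (Suc N)" .
    moreover have "h / (1 + h) = 1 / real (Suc N)" using Suc by (simp add: h_def field_simps)
    ultimately show ?thesis using True by (simp add: m_def powr_divide powr_minus_divide)
  next
    case False
    then show ?thesis by (simp add: m_def)
  qed
  \<comment> \<open>Any two roots are both equal to the Hardy constant.\<close>
  have root_unique: "c = c'" if "c > L" "c' > L" "f c = 1 / real (Suc N)" "f c' = 1 / real (Suc N)" for c c'
  proof -
    have "hardy_lambda (Suc N) q = c" "hardy_lambda (Suc N) q = c'"
      using that L(1) above q unfolding f_def
      by (auto intro!: hardy_lambda_eq_orbit_root simp del: T_orbit.simps)
    then show ?thesis by simp
  qed
  have large: "\<exists>b>a. f b > 1 / real (Suc N)" for a
  proof -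
    have "\<forall>\<^sub>F \<Lambda> in at_top. f \<Lambda> / \<Lambda> > 1 / 2"
      unfolding f_def by (rule order_tendstoD(1)[OF T_orbit_ratio_tendsto_1]) auto
    then have "\<forall>\<^sub>F \<Lambda> in at_top. f \<Lambda> > 1 / real (Suc N) \<and> \<Lambda> > a"
      using eventually_gt_at_top[of a] eventually_gt_at_top[of 2]
    proof eventually_elim
      case (elim \<Lambda>)
      then have "f \<Lambda> > 1" by (simp add: less_divide_eq)
      moreover have "1 / real (Suc N) \<le> 1" by simp
      ultimately show ?case using elim by linarith
    qed
    then show ?thesis using eventually_happens trivial_limit_at_top_linorder by blast
  qed
  have root_above: "\<exists>c\<ge>a. f c = 1 / real (Suc N)" if "a > L" "f a \<le> 1 / real (Suc N)" for a
  proof -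
    obtain b where b: "b > a" "f b > 1 / real (Suc N)" using large by blast
    have "continuous_on {a..b} f" using that by (intro continuous_on_subset[OF f_cont]) auto
    then show ?thesis using IVT'[of f a "1 / real (Suc N)" b] that b by auto
  qed
  obtain a where a: "a > L" "f a < 1 / real (Suc N)"
    using eventually_happens[OF eventually_conj[OF order_tendstoD(2)[OF f_lim below] eventually_at_right_less]]
    by (auto simp: trivial_limit_at_right_real)
  then obtain c where c: "c > L" "f c = 1 / real (Suc N)" using root_above[of a] less_le_trans less_imp_le by blast
  have "f \<Lambda> > 1 / real (Suc N)" if "\<Lambda> > c" for \<Lambda>
  proof (rule ccontr)
    assume "\<not> ?thesis"
    then have "f \<Lambda> \<le> 1 / real (Suc N)" "\<Lambda> > L" using that c by auto
    from root_above[OF this(2,1)] obtain c' where "c' \<ge> \<Lambda>" "f c' = 1 / real (Suc N)" by blast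
    then show False using root_unique[of c c'] that c by auto
  qed
  then have "admissible_through (Suc (Suc N)) (T_orbit q \<Lambda>)" if "\<Lambda> > c" for \<Lambda>
    using above[of \<Lambda>] that c unfolding admissible_through_def f_def
    by (metis less_Suc_eq less_trans)
  moreover have "real (Suc N) * T_orbit q c (Suc N) = 1" using c(2) by (simp add: f_def del: T_orbit.simps)
  ultimately show ?case using c L(1) above[of c] by (intro exI[of _ c]) (auto simp del: T_orbit.simps)
qed

section \<open>Majorized power series in several complex variables\<close>

definition monomial_value :: "('n::finite \<Rightarrow> nat) \<Rightarrow> complex ^ 'n \<Rightarrow> complex" where
  "monomial_value \<alpha> v = (\<Prod>i\<in>UNIV. (v $ i) ^ \<alpha> i)"

definition polydisc :: "complex ^ 'n \<Rightarrow> real \<Rightarrow> (complex ^ 'n) set" where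
  "polydisc p R = {x. \<forall>i. norm (x $ i - p $ i) \<le> R}"

text \<open>The weighted \<open>\<ell>\<^sup>1\<close> norm of the coefficients at radius \<open>R\<close> is at most \<open>M\<close>. Such functions form a Banach
  algebra: the bounds add, multiply and sum up along with the functions.\<close>

definition majorized_at ::
    "complex ^ 'n::finite \<Rightarrow> real \<Rightarrow> real \<Rightarrow> (complex ^ 'n \<Rightarrow> complex) \<Rightarrow> bool" where
  "majorized_at p R M f \<longleftrightarrow>
     (\<exists>a. (\<lambda>\<alpha>. norm (a \<alpha>) * R ^ sum \<alpha> UNIV) summable_on UNIV
        \<and> (\<Sum>\<^sub>\<infinity>\<alpha>. norm (a \<alpha>) * R ^ sum \<alpha> UNIV) \<le> M
        \<and> (\<forall>x\<in>polydisc p R. ((\<lambda>\<alpha>. a \<alpha> * monomial_value \<alpha> (x - p)) has_sum f x) UNIV))"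

lemma norm_monomial_value_le:
  assumes "x \<in> polydisc p R"
  shows "norm (monomial_value \<alpha> (x - p)) \<le> R ^ sum \<alpha> UNIV"
proof -
  have "norm (monomial_value \<alpha> (x - p)) = (\<Prod>i\<in>UNIV. norm (x $ i - p $ i) ^ \<alpha> i)"
    by (simp add: monomial_value_def prod_norm [symmetric] norm_power)
  also have "\<dots> \<le> (\<Prod>i\<in>UNIV. R ^ \<alpha> i)"
    using assms by (intro prod_mono) (auto simp: polydisc_def intro: power_mono)
  finally show ?thesis by (simp add: power_sum)
qed

lemma norm_term_le:
  assumes "x \<in> polydisc p R"
  shows "norm (c * monomial_value \<alpha> (x - p)) \<le> norm c * R ^ sum \<alpha> UNIV"
  using norm_monomial_value_le[OF assms] by (simp add: norm_mult mult_left_mono)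

text \<open>An absolutely convergent sum of monomials over any index set, in which the same exponent may occur
  many times, becomes a power series by collecting equal exponents. Products and infinite sums of
  power series both arise in this form.\<close>

lemma majorized_at_regroup:
  fixes c :: "'i \<Rightarrow> complex" and e :: "'i \<Rightarrow> 'n::finite \<Rightarrow> nat"
  assumes R: "R > 0"
    and summ: "(\<lambda>i. norm (c i) * R ^ sum (e i) UNIV) summable_on A"
    and bound: "(\<Sum>\<^sub>\<infinity>i\<in>A. norm (c i) * R ^ sum (e i) UNIV) \<le> M"
    and val: "\<And>x. x \<in> polydisc p R \<Longrightarrow>
                ((\<lambda>i. c i * monomial_value (e i) (x - p)) has_sum f x) A"
  shows "majorized_at p R M f"
proof -
  define B where "B \<alpha> = {i \<in> A. e i = \<alpha>}" for \<alpha>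
  define S where "S i = norm (c i) * R ^ sum (e i) UNIV" for i
  define a where "a \<alpha> = infsum c (B \<alpha>)" for \<alpha>
  \<comment> \<open>The index set is the disjoint union of the fibres of e.\<close>
  have bij: "bij_betw snd (Sigma UNIV B) A"
    by (rule bij_betwI[where g = "\<lambda>i. (e i, i)"]) (auto simp: B_def)
  have sS: "(\<lambda>z. S (snd z)) summable_on Sigma UNIV B"
    using summ summable_on_reindex_bij_betw[OF bij, of S] unfolding S_def by blast
  have iS: "infsum (\<lambda>z. S (snd z)) (Sigma UNIV B) \<le> M"
    using bound infsum_reindex_bij_betw[OF bij, of S] unfolding S_def by simp
  have sB: "S summable_on B \<alpha>" for \<alpha>
    using summ unfolding S_def[symmetric] by (rule summable_on_subset_banach) (auto simp: B_def)
  have SB: "S i = norm (c i) * R ^ sum \<alpha> UNIV" if "i \<in> B \<alpha>" for i \<alpha>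
    using that by (auto simp: S_def B_def)
  have cB: "(\<lambda>i. norm (c i)) summable_on B \<alpha>" for \<alpha>
  proof -
    have "(\<lambda>i. norm (c i) * R ^ sum \<alpha> UNIV) summable_on B \<alpha>"
      using sB[of \<alpha>] SB by (simp cong: summable_on_cong)
    from summable_on_cmult_left[OF this, of "inverse (R ^ sum \<alpha> UNIV)"]
    show ?thesis using R by (simp add: mult.assoc)
  qed
  have a_le: "norm (a \<alpha>) * R ^ sum \<alpha> UNIV \<le> infsum S (B \<alpha>)" for \<alpha>
  proof -
    have "norm (a \<alpha>) * R ^ sum \<alpha> UNIV \<le> (\<Sum>\<^sub>\<infinity>i\<in>B \<alpha>. norm (c i)) * R ^ sum \<alpha> UNIV"
      unfolding a_def using R cB by (intro mult_right_mono norm_infsum_bound) auto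
    also have "\<dots> = (\<Sum>\<^sub>\<infinity>i\<in>B \<alpha>. norm (c i) * R ^ sum \<alpha> UNIV)"
      using cB by (intro infsum_cmult_left[symmetric]) auto
    also have "\<dots> = infsum S (B \<alpha>)"
      using SB by (intro infsum_cong) auto
    finally show ?thesis .
  qed
  have sumS: "(\<lambda>\<alpha>. infsum S (B \<alpha>)) summable_on UNIV"
    using summable_on_Sigma_banach[of "\<lambda>_. S" UNIV B] sS by (simp add: case_prod_unfold)
  have infS: "(\<Sum>\<^sub>\<infinity>\<alpha>. infsum S (B \<alpha>)) \<le> M"
    using infsum_Sigma_banach[OF sS] iS by simp
  have sum_a: "(\<lambda>\<alpha>. norm (a \<alpha>) * R ^ sum \<alpha> UNIV) summable_on UNIV"
    by (rule summable_on_comparison_test[OF sumS]) (use a_le R in auto)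
  moreover have "(\<Sum>\<^sub>\<infinity>\<alpha>. norm (a \<alpha>) * R ^ sum \<alpha> UNIV) \<le> M"
    using infsum_mono[OF sum_a sumS] a_le infS by force
  moreover have "((\<lambda>\<alpha>. a \<alpha> * monomial_value \<alpha> (x - p)) has_sum f x) UNIV"
    if x: "x \<in> polydisc p R" for x
  proof (rule has_sum_SigmaD)
    show "((\<lambda>z. c (snd z) * monomial_value (e (snd z)) (x - p)) has_sum f x) (Sigma UNIV B)"
      using val[OF x] has_sum_reindex_bij_betw[OF bij, of "\<lambda>i. c i * monomial_value (e i) (x - p)" "f x"]
      by (rule iffD2[rotated])
    fix \<alpha> :: "'n \<Rightarrow> nat"
    have "((\<lambda>i. c i * monomial_value \<alpha> (x - p)) has_sum a \<alpha> * monomial_value \<alpha> (x - p)) (B \<alpha>)"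
      unfolding a_def
      by (intro has_sum_cmult_left has_sum_infsum) (rule Infinite_Sum.abs_summable_summable[OF cB])
    then show "((\<lambda>y. c (snd (\<alpha>, y)) * monomial_value (e (snd (\<alpha>, y))) (x - p)) has_sum
                  a \<alpha> * monomial_value \<alpha> (x - p)) (B \<alpha>)"
      by (rule has_sum_cong[THEN iffD1, rotated]) (auto simp: B_def)
  qed
  ultimately show ?thesis unfolding majorized_at_def by blast
qed

lemma majorized_at_norm_le:
  assumes "majorized_at p R M f" and x: "x \<in> polydisc p R"
  shows "norm (f x) \<le> M"
proof -
  obtain a where a: "(\<lambda>\<alpha>. norm (a \<alpha>) * R ^ sum \<alpha> UNIV) summable_on UNIV"
      "(\<Sum>\<^sub>\<infinity>\<alpha>. norm (a \<alpha>) * R ^ sum \<alpha> UNIV) \<le> M"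
      "((\<lambda>\<alpha>. a \<alpha> * monomial_value \<alpha> (x - p)) has_sum f x) UNIV"
    using assms unfolding majorized_at_def by blast
  have s: "(\<lambda>\<alpha>. norm (a \<alpha> * monomial_value \<alpha> (x - p))) summable_on UNIV"
    by (rule Infinite_Sum.abs_summable_on_comparison_test'[OF a(1)]) (rule norm_term_le[OF x])
  have "norm (f x) \<le> (\<Sum>\<^sub>\<infinity>\<alpha>. norm (a \<alpha> * monomial_value \<alpha> (x - p)))"
    using norm_infsum_bound[OF s] a(3) by (simp add: infsumI)
  also have "\<dots> \<le> (\<Sum>\<^sub>\<infinity>\<alpha>. norm (a \<alpha>) * R ^ sum \<alpha> UNIV)"
    using s a(1) norm_term_le[OF x] by (intro infsum_mono) auto
  finally show ?thesis using a(2) by simp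
qed

lemma majorized_at_const:
  assumes "R > 0"
  shows "majorized_at p R (norm c) (\<lambda>_. c)"
  by (rule majorized_at_regroup[where A = "{()}" and c = "\<lambda>_. c" and e = "\<lambda>_ _. 0"])
     (use assms in \<open>auto simp: monomial_value_def intro: has_sum_finiteI\<close>)

lemma majorized_at_shifted_coordinate:
  fixes p :: "complex ^ 'n"
  assumes "R > 0"
  shows "majorized_at p R R (\<lambda>x. x $ j - p $ j)"
proof -
  have "monomial_value (\<lambda>i. if i = j then 1 else 0) v = v $ j" for v :: "complex ^ 'n"
  proof -
    have "monomial_value (\<lambda>i. if i = j then 1 else 0) v = (\<Prod>i\<in>UNIV. if i = j then v $ i else 1)"
      unfolding monomial_value_def by (intro prod.cong) auto
    then show ?thesis by simp
  qed
  then show ?thesis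
    using assms
    by (intro majorized_at_regroup[where A = "{()}" and c = "\<lambda>_. 1" and e = "\<lambda>_ i. if i = j then 1 else 0"])
       (auto intro: has_sum_finiteI)
qed

lemma majorized_at_add:
  assumes "majorized_at p R M f" "majorized_at p R L g" "R > 0"
  shows "majorized_at p R (M + L) (\<lambda>x. f x + g x)"
proof -
  obtain a where a: "(\<lambda>\<alpha>. norm (a \<alpha>) * R ^ sum \<alpha> UNIV) summable_on UNIV"
      "(\<Sum>\<^sub>\<infinity>\<alpha>. norm (a \<alpha>) * R ^ sum \<alpha> UNIV) \<le> M"
      "\<And>x. x \<in> polydisc p R \<Longrightarrow> ((\<lambda>\<alpha>. a \<alpha> * monomial_value \<alpha> (x - p)) has_sum f x) UNIV"
    using assms(1) unfolding majorized_at_def by blast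
  obtain b where b: "(\<lambda>\<alpha>. norm (b \<alpha>) * R ^ sum \<alpha> UNIV) summable_on UNIV"
      "(\<Sum>\<^sub>\<infinity>\<alpha>. norm (b \<alpha>) * R ^ sum \<alpha> UNIV) \<le> L"
      "\<And>x. x \<in> polydisc p R \<Longrightarrow> ((\<lambda>\<alpha>. b \<alpha> * monomial_value \<alpha> (x - p)) has_sum g x) UNIV"
    using assms(2) unfolding majorized_at_def by blast
  let ?S = "\<lambda>\<alpha>. norm (a \<alpha>) * R ^ sum \<alpha> UNIV + norm (b \<alpha>) * R ^ sum \<alpha> UNIV"
  have S: "?S summable_on UNIV" by (intro summable_on_add a b)
  have le: "norm (a \<alpha> + b \<alpha>) * R ^ sum \<alpha> UNIV \<le> ?S \<alpha>" for \<alpha>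
    using assms(3) by (simp add: distrib_right[symmetric] mult_right_mono norm_triangle_ineq)
  have s: "(\<lambda>\<alpha>. norm (a \<alpha> + b \<alpha>) * R ^ sum \<alpha> UNIV) summable_on UNIV"
    by (rule summable_on_comparison_test[OF S]) (use le assms(3) in auto)
  have "(\<Sum>\<^sub>\<infinity>\<alpha>. norm (a \<alpha> + b \<alpha>) * R ^ sum \<alpha> UNIV) \<le> (\<Sum>\<^sub>\<infinity>\<alpha>. ?S \<alpha>)"
    by (intro infsum_mono s S le)
  also have "\<dots> \<le> M + L" using a b by (subst infsum_add) auto
  finally show ?thesis
    unfolding majorized_at_def using s a(3) b(3)
    by (intro exI[of _ "\<lambda>\<alpha>. a \<alpha> + b \<alpha>"]) (auto simp: distrib_right intro!: has_sum_add)
qed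

text \<open>The double series of products is indexed by pairs of exponents, and \<open>majorized_at_regroup\<close> collects
  it into the Cauchy product.\<close>

lemma majorized_at_mult:
  fixes p :: "complex ^ 'n::finite"
  assumes "majorized_at p R M f" "majorized_at p R L g" "R > 0"
  shows "majorized_at p R (M * L) (\<lambda>x. f x * g x)"
proof -
  obtain a where a: "(\<lambda>\<alpha>. norm (a \<alpha>) * R ^ sum \<alpha> UNIV) summable_on UNIV"
      "(\<Sum>\<^sub>\<infinity>\<alpha>. norm (a \<alpha>) * R ^ sum \<alpha> UNIV) \<le> M"
      "\<And>x. x \<in> polydisc p R \<Longrightarrow> ((\<lambda>\<alpha>. a \<alpha> * monomial_value \<alpha> (x - p)) has_sum f x) UNIV"
    using assms(1) unfolding majorized_at_def by blast
  obtain b where b: "(\<lambda>\<alpha>. norm (b \<alpha>) * R ^ sum \<alpha> UNIV) summable_on UNIV"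
      "(\<Sum>\<^sub>\<infinity>\<alpha>. norm (b \<alpha>) * R ^ sum \<alpha> UNIV) \<le> L"
      "\<And>x. x \<in> polydisc p R \<Longrightarrow> ((\<lambda>\<alpha>. b \<alpha> * monomial_value \<alpha> (x - p)) has_sum g x) UNIV"
    using assms(2) unfolding majorized_at_def by blast
  let ?A = "\<lambda>\<alpha>. norm (a \<alpha>) * R ^ sum \<alpha> UNIV" and ?B = "\<lambda>\<alpha>. norm (b \<alpha>) * R ^ sum \<alpha> UNIV"
  let ?c = "\<lambda>z. a (fst z) * b (snd z)" and ?e = "\<lambda>z i. (fst z i + snd z i :: nat)"
  have nn: "0 \<le> ?A \<alpha>" "0 \<le> ?B \<alpha>" for \<alpha> using assms(3) by auto
  have row: "((\<lambda>\<beta>. ?A \<alpha> * ?B \<beta>) has_sum ?A \<alpha> * infsum ?B UNIV) UNIV" for \<alpha>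
    by (intro has_sum_cmult_right has_sum_infsum b)
  have col: "((\<lambda>\<alpha>. ?A \<alpha> * infsum ?B UNIV) has_sum infsum ?A UNIV * infsum ?B UNIV) UNIV"
    by (intro has_sum_cmult_left has_sum_infsum a)
  have term_eq: "\<And>z. norm (?c z) * R ^ sum (?e z) UNIV = ?A (fst z) * ?B (snd z)"
    by (simp add: norm_mult sum.distrib power_add)
  have sm: "(\<lambda>z. norm (?c z) * R ^ sum (?e z) UNIV) summable_on UNIV \<times> UNIV"
    unfolding term_eq
  proof (rule summable_on_SigmaI)
    show "((\<lambda>\<beta>. ?A (fst (\<alpha>, \<beta>)) * ?B (snd (\<alpha>, \<beta>))) has_sum ?A \<alpha> * infsum ?B UNIV) UNIV" for \<alpha>
      using row by simp
    show "(\<lambda>\<alpha>. ?A \<alpha> * infsum ?B UNIV) summable_on UNIV"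
      using col by (rule has_sum_imp_summable)
  qed (simp add: assms(3) less_imp_le)
  have hs: "((\<lambda>z. norm (?c z) * R ^ sum (?e z) UNIV) has_sum infsum ?A UNIV * infsum ?B UNIV)
              (UNIV \<times> UNIV)"
    unfolding term_eq
    by (rule has_sum_SigmaI[OF _ col sm[unfolded term_eq]]) (simp add: row)
  have M0: "0 \<le> M" using a(2) infsum_nonneg[of UNIV ?A] nn by force
  show ?thesis
  proof (rule majorized_at_regroup[OF assms(3) sm])
    show "(\<Sum>\<^sub>\<infinity>z\<in>UNIV \<times> UNIV. norm (?c z) * R ^ sum (?e z) UNIV) \<le> M * L"
      unfolding infsumI[OF hs] using a(2) b(2) M0 nn by (intro mult_mono infsum_nonneg) auto
    fix x assume x: "x \<in> polydisc p R"
    have t: "monomial_value (\<lambda>i. \<alpha> i + \<beta> i) v = monomial_value \<alpha> v * monomial_value \<beta> v"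
      for \<alpha> \<beta> :: "'n \<Rightarrow> nat" and v
      by (simp add: monomial_value_def power_add prod.distrib)
    have "(\<lambda>z. norm (?c z * monomial_value (?e z) (x - p))) summable_on UNIV \<times> UNIV"
      by (rule Infinite_Sum.abs_summable_on_comparison_test'[OF sm]) (rule norm_term_le[OF x])
    then have s2: "(\<lambda>z. ?c z * monomial_value (?e z) (x - p)) summable_on UNIV \<times> UNIV"
      by (rule Infinite_Sum.abs_summable_summable)
    show "((\<lambda>z. ?c z * monomial_value (?e z) (x - p)) has_sum f x * g x) (UNIV \<times> UNIV)"
    proof (rule has_sum_SigmaI[OF _ _ s2])
      show "((\<lambda>\<alpha>. (a \<alpha> * monomial_value \<alpha> (x - p)) * g x) has_sum f x * g x) UNIV"
        by (intro has_sum_cmult_left a x)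
      show "((\<lambda>\<beta>. ?c (\<alpha>, \<beta>) * monomial_value (?e (\<alpha>, \<beta>)) (x - p)) has_sum
              (a \<alpha> * monomial_value \<alpha> (x - p)) * g x) UNIV" for \<alpha>
        using has_sum_cmult_right[OF b(3)[OF x], of "a \<alpha> * monomial_value \<alpha> (x - p)"]
        by (simp add: t mult_ac)
    qed
  qed
qed

lemma majorized_at_power:
  assumes "majorized_at p R M f" "R > 0"
  shows "majorized_at p R (M ^ k) (\<lambda>x. f x ^ k)"
proof (induction k)
  case 0
  show ?case using majorized_at_const[OF assms(2), of p 1] by simp
next
  case (Suc k)
  show ?case using majorized_at_mult[OF assms(1) Suc assms(2)] by simp
qed

text \<open>The double series is indexed by the summand and the exponent; its total norm is bounded by the sum of
  the individual bounds.\<close>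

lemma majorized_at_series:
  fixes p :: "complex ^ 'n::finite"
  assumes F: "\<And>k. majorized_at p R (M k) (F k)" and R: "R > 0"
    and M: "M summable_on (UNIV :: nat set)"
    and val: "\<And>x. x \<in> polydisc p R \<Longrightarrow> ((\<lambda>k. F k x) has_sum f x) UNIV"
  shows "majorized_at p R (infsum M UNIV) f"
proof -
  define P where "P k a \<longleftrightarrow> (\<lambda>\<alpha>. norm (a \<alpha>) * R ^ sum \<alpha> UNIV) summable_on UNIV
        \<and> (\<Sum>\<^sub>\<infinity>\<alpha>. norm (a \<alpha>) * R ^ sum \<alpha> UNIV) \<le> M k
        \<and> (\<forall>x\<in>polydisc p R. ((\<lambda>\<alpha>. a \<alpha> * monomial_value \<alpha> (x - p)) has_sum F k x) UNIV)" for k a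
  have "\<forall>k. \<exists>a. P k a" using F unfolding majorized_at_def P_def by blast
  then obtain a where "\<forall>k. P k (a k)" by (rule choice[THEN exE])
  then have a: "\<And>k. (\<lambda>\<alpha>. norm (a k \<alpha>) * R ^ sum \<alpha> UNIV) summable_on UNIV"
      "\<And>k. (\<Sum>\<^sub>\<infinity>\<alpha>. norm (a k \<alpha>) * R ^ sum \<alpha> UNIV) \<le> M k"
      "\<And>k x. x \<in> polydisc p R \<Longrightarrow>
         ((\<lambda>\<alpha>. a k \<alpha> * monomial_value \<alpha> (x - p)) has_sum F k x) UNIV"
    unfolding P_def by blast+
  let ?S = "\<lambda>k \<alpha>. norm (a k \<alpha>) * R ^ sum \<alpha> UNIV"
  let ?c = "\<lambda>z. a (fst z) (snd z)"
  have nn: "0 \<le> ?S k \<alpha>" for k \<alpha> using R by auto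
  have row: "((\<lambda>\<alpha>. ?S k \<alpha>) has_sum infsum (?S k) UNIV) UNIV" for k
    by (intro has_sum_infsum a)
  have rows: "(\<lambda>k. infsum (?S k) UNIV) summable_on UNIV"
    by (rule summable_on_comparison_test[OF M]) (use a(2) nn in \<open>auto intro: infsum_nonneg\<close>)
  have sm: "(\<lambda>z. norm (?c z) * R ^ sum (snd z) UNIV) summable_on UNIV \<times> UNIV"
    by (rule summable_on_SigmaI[OF _ rows]) (use row nn in auto)
  have hs: "((\<lambda>z. norm (?c z) * R ^ sum (snd z) UNIV) has_sum (\<Sum>\<^sub>\<infinity>k. infsum (?S k) UNIV))
              (UNIV \<times> UNIV)"
    by (rule has_sum_SigmaI[OF _ has_sum_infsum[OF rows] sm]) (use row in simp)
  show ?thesis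
  proof (rule majorized_at_regroup[OF R sm])
    show "(\<Sum>\<^sub>\<infinity>z\<in>UNIV \<times> UNIV. norm (?c z) * R ^ sum (snd z) UNIV) \<le> infsum M UNIV"
      unfolding infsumI[OF hs] by (intro infsum_mono rows M a)
    fix x assume x: "x \<in> polydisc p R"
    have "(\<lambda>z. norm (?c z * monomial_value (snd z) (x - p))) summable_on UNIV \<times> UNIV"
      by (rule Infinite_Sum.abs_summable_on_comparison_test'[OF sm]) (rule norm_term_le[OF x])
    then have s2: "(\<lambda>z. ?c z * monomial_value (snd z) (x - p)) summable_on UNIV \<times> UNIV"
      by (rule Infinite_Sum.abs_summable_summable)
    show "((\<lambda>z. ?c z * monomial_value (snd z) (x - p)) has_sum f x) (UNIV \<times> UNIV)"
      by (rule has_sum_SigmaI[OF _ val[OF x] s2]) (use a(3)[OF x] in simp)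
  qed
qed

text \<open>Without a constant term every monomial has positive degree, so it gains a factor \<open>s\<close> when the radius is
  multiplied by \<open>s\<close>. This makes the bound as small as desired.\<close>

lemma majorized_at_shrink:
  fixes p :: "complex ^ 'n::finite"
  assumes "majorized_at p R M f" "R > 0" "f p = 0" "0 < s" "s \<le> 1"
  shows "majorized_at p (s * R) (s * M) f"
proof -
  obtain a where a: "(\<lambda>\<alpha>. norm (a \<alpha>) * R ^ sum \<alpha> UNIV) summable_on UNIV"
      "(\<Sum>\<^sub>\<infinity>\<alpha>. norm (a \<alpha>) * R ^ sum \<alpha> UNIV) \<le> M"
      "\<And>x. x \<in> polydisc p R \<Longrightarrow> ((\<lambda>\<alpha>. a \<alpha> * monomial_value \<alpha> (x - p)) has_sum f x) UNIV"
    using assms(1) unfolding majorized_at_def by blast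
  have "p \<in> polydisc p R" using assms by (simp add: polydisc_def)
  note a(3)[OF this]
  moreover have "((\<lambda>\<alpha>. a \<alpha> * monomial_value \<alpha> (p - p)) has_sum a (\<lambda>_. 0)) UNIV"
  proof (rule has_sum_finite_neutralI[of "{\<lambda>_. 0}"])
    fix \<alpha> :: "'n \<Rightarrow> nat" assume "\<alpha> \<in> UNIV - {\<lambda>_. 0}"
    then obtain i where "\<alpha> i \<noteq> 0" by auto
    then show "a \<alpha> * monomial_value \<alpha> (p - p) = 0"
      by (auto simp: monomial_value_def intro!: exI[of _ i])
  qed (auto simp: monomial_value_def)
  ultimately have a0: "a (\<lambda>_. 0) = 0" using assms(3) has_sum_unique by metis
  have le: "norm (a \<alpha>) * (s * R) ^ sum \<alpha> UNIV \<le> s * (norm (a \<alpha>) * R ^ sum \<alpha> UNIV)" for \<alpha>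
  proof (cases "\<alpha> = (\<lambda>_. 0)")
    case True
    then show ?thesis using a0 by simp
  next
    case False
    then have "sum \<alpha> UNIV \<noteq> 0" by auto
    then have "1 \<le> sum \<alpha> UNIV" by linarith
    then have "s ^ sum \<alpha> UNIV \<le> s ^ 1" using assms by (intro power_decreasing) auto
    then have "s ^ sum \<alpha> UNIV * (norm (a \<alpha>) * R ^ sum \<alpha> UNIV) \<le> s * (norm (a \<alpha>) * R ^ sum \<alpha> UNIV)"
      using assms by (intro mult_right_mono) auto
    then show ?thesis by (simp add: power_mult_distrib mult_ac)
  qed
  have S: "(\<lambda>\<alpha>. s * (norm (a \<alpha>) * R ^ sum \<alpha> UNIV)) summable_on UNIV"
    by (intro summable_on_cmult_right a)
  have s: "(\<lambda>\<alpha>. norm (a \<alpha>) * (s * R) ^ sum \<alpha> UNIV) summable_on UNIV"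
    by (rule summable_on_comparison_test[OF S]) (use le assms in auto)
  have "(\<Sum>\<^sub>\<infinity>\<alpha>. norm (a \<alpha>) * (s * R) ^ sum \<alpha> UNIV) \<le> (\<Sum>\<^sub>\<infinity>\<alpha>. s * (norm (a \<alpha>) * R ^ sum \<alpha> UNIV))"
    by (intro infsum_mono s S le)
  also have "\<dots> \<le> s * M" using a assms by (subst infsum_cmult_right) auto
  finally have i: "(\<Sum>\<^sub>\<infinity>\<alpha>. norm (a \<alpha>) * (s * R) ^ sum \<alpha> UNIV) \<le> s * M" .
  have "s * R \<le> R" using assms by (simp add: mult_le_cancel_right1)
  then have "polydisc p (s * R) \<subseteq> polydisc p R" unfolding polydisc_def using order_trans by blast
  then show ?thesis unfolding majorized_at_def using s i a(3) by blast
qed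

text \<open>Expand \<open>G\<close> into its Taylor series at \<open>f p\<close> and insert \<open>f x - f p\<close>. After shrinking the radius, the bound of
  \<open>f x - f p\<close> lies inside the disc of convergence, so the series of the powers converges in norm.\<close>

lemma majorized_at_compose:
  fixes p :: "complex ^ 'n::finite"
  assumes f: "majorized_at p R M f" and R: "R > 0"
    and G: "G holomorphic_on S" "open S" "f p \<in> S"
  shows "\<exists>s. 0 < s \<and> s \<le> 1 \<and> (\<exists>L. majorized_at p (s * R) L (\<lambda>x. G (f x)))"
proof -
  define b where "b = f p"
  obtain \<rho> where \<rho>: "\<rho> > 0" "ball b \<rho> \<subseteq> S" using G b_def open_contains_ball by blast
  have hol: "G holomorphic_on ball b \<rho>" using G(1) \<rho>(2) by (rule holomorphic_on_subset)
  define K where "K = M + norm b"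
  have f0: "majorized_at p R K (\<lambda>x. f x - b)"
    using majorized_at_add[OF f majorized_at_const[OF R, of p "-b"] R] by (simp add: K_def)
  have pin: "p \<in> polydisc p R" using R by (simp add: polydisc_def)
  have K0: "0 \<le> K" using majorized_at_norm_le[OF f0 pin] norm_ge_zero order_trans by blast
  \<comment> \<open>This factor brings the bound s * K below half of the radius of convergence of G.\<close>
  define s where "s = min 1 (\<rho> / (2 * (K + 1)))"
  have s: "0 < s" "s \<le> 1" using \<rho> K0 by (auto simp: s_def)
  define L where "L = s * K"
  have "s * (K + 1) \<le> \<rho> / (2 * (K + 1)) * (K + 1)"
    using K0 by (intro mult_right_mono) (auto simp: s_def)
  also have "\<dots> = \<rho> / 2" using K0 by (simp add: field_simps)
  finally have L: "0 \<le> L" "L \<le> \<rho> / 2" using s K0 by (auto simp: L_def algebra_simps)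
  define c where "c k = (deriv ^^ k) G b / fact k" for k
  have sR: "s * R > 0" using s R by simp
  have f1: "majorized_at p (s * R) L (\<lambda>x. f x - b)"
    unfolding L_def by (rule majorized_at_shrink[OF f0 R]) (use s in \<open>auto simp: b_def\<close>)
  have Fk: "majorized_at p (s * R) (norm (c k) * L ^ k) (\<lambda>x. c k * (f x - b) ^ k)" for k
    by (intro majorized_at_mult majorized_at_const majorized_at_power f1 sR)
  \<comment> \<open>A point of the disc farther from the centre than L gives absolute convergence at radius L.\<close>
  have "b + of_real (3 * \<rho> / 4) \<in> ball b \<rho>" using \<rho> by (simp add: dist_norm)
  from holomorphic_power_series[OF hol this]
  have "summable (\<lambda>k. c k * of_real (3 * \<rho> / 4) ^ k)" unfolding c_def by (auto simp: sums_iff)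
  from powser_insidea[OF this, of "of_real L"]
  have sm: "summable (\<lambda>k. norm (c k) * L ^ k)"
    using L \<rho> by (simp add: norm_mult norm_power)
  then have Msum: "(\<lambda>k. norm (c k) * L ^ k) summable_on UNIV"
    using L by (intro norm_summable_imp_summable_on) (simp add: norm_mult norm_power)
  have "majorized_at p (s * R) (\<Sum>\<^sub>\<infinity>k. norm (c k) * L ^ k) (\<lambda>x. G (f x))"
  proof (rule majorized_at_series[OF Fk sR Msum])
    fix x assume x: "x \<in> polydisc p (s * R)"
    have n: "norm (f x - b) \<le> L" by (rule majorized_at_norm_le[OF f1 x])
    then have "f x \<in> ball b \<rho>" using L \<rho> by (simp add: dist_norm norm_minus_commute)
    from holomorphic_power_series[OF hol this]
    have "(\<lambda>k. c k * (f x - b) ^ k) sums G (f x)" unfolding c_def .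
    moreover have "summable (\<lambda>k. norm (c k * (f x - b) ^ k))"
      by (rule summable_comparison_test'[OF sm, of 0])
         (use n in \<open>auto simp: norm_mult norm_power intro!: mult_left_mono power_mono\<close>)
    ultimately show "((\<lambda>k. c k * (f x - b) ^ k) has_sum G (f x)) UNIV"
      by (intro norm_summable_imp_has_sum)
  qed
  then show ?thesis using s by blast
qed

definition complex_analytic_at :: "(complex ^ 'n::finite \<Rightarrow> complex) \<Rightarrow> complex ^ 'n \<Rightarrow> bool" where
  "complex_analytic_at f p \<longleftrightarrow> (\<exists>R>0. \<exists>M. majorized_at p R M f)"

lemma majorized_at_smaller_radius:
  fixes p :: "complex ^ 'n::finite"
  assumes "majorized_at p R M f" "0 < r" "r \<le> R"
  shows "\<exists>L. majorized_at p r L f"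
proof -
  have R: "R > 0" using assms by simp
  have "majorized_at p R (M + norm (- f p)) (\<lambda>x. f x + - f p)"
    by (intro majorized_at_add majorized_at_const assms R)
  from majorized_at_shrink[OF this R, of "r / R"]
  have "majorized_at p r (r / R * (M + norm (- f p))) (\<lambda>x. f x + - f p)"
    using assms R by simp
  from majorized_at_add[OF this majorized_at_const[OF assms(2), of p "f p"] assms(2)]
  show ?thesis by auto
qed

lemma complex_analytic_at_common_radius:
  assumes "complex_analytic_at f p" "complex_analytic_at g p"
  obtains R M L where "R > 0" "majorized_at p R M f" "majorized_at p R L g"
proof -
  obtain R1 R2 M L where *: "R1 > 0" "R2 > 0" "majorized_at p R1 M f" "majorized_at p R2 L g"
    using assms unfolding complex_analytic_at_def by blast
  have "\<exists>M. majorized_at p (min R1 R2) M f" "\<exists>M. majorized_at p (min R1 R2) M g"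
    using * by (auto intro!: majorized_at_smaller_radius[OF *(3)] majorized_at_smaller_radius[OF *(4)])
  then show ?thesis using that[of "min R1 R2"] * by auto
qed

lemma complex_analytic_at_const: "complex_analytic_at (\<lambda>_. c) p"
  unfolding complex_analytic_at_def using majorized_at_const zero_less_one by blast

lemma complex_analytic_at_add:
  assumes "complex_analytic_at f p" "complex_analytic_at g p"
  shows "complex_analytic_at (\<lambda>x. f x + g x) p"
proof -
  obtain R M L where "R > 0" "majorized_at p R M f" "majorized_at p R L g"
    using complex_analytic_at_common_radius[OF assms] .
  then show ?thesis
    unfolding complex_analytic_at_def using majorized_at_add by blast
qed

lemma complex_analytic_at_mult:
  assumes "complex_analytic_at f p" "complex_analytic_at g p"
  shows "complex_analytic_at (\<lambda>x. f x * g x) p"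
proof -
  obtain R M L where "R > 0" "majorized_at p R M f" "majorized_at p R L g"
    using complex_analytic_at_common_radius[OF assms] .
  then show ?thesis
    unfolding complex_analytic_at_def using majorized_at_mult by blast
qed

lemma complex_analytic_at_compose:
  assumes "complex_analytic_at f p" "G holomorphic_on S" "open S" "f p \<in> S"
  shows "complex_analytic_at (\<lambda>x. G (f x)) p"
proof -
  obtain R M where R: "R > 0" "majorized_at p R M f"
    using assms(1) unfolding complex_analytic_at_def by blast
  obtain s L where "0 < s" "majorized_at p (s * R) L (\<lambda>x. G (f x))"
    using majorized_at_compose[where f = f and G = G, OF R(2,1) assms(2-4)] by blast
  then show ?thesis
    unfolding complex_analytic_at_def using R(1) mult_pos_pos by blast
qed

lemma complex_analytic_at_uminus:
  assumes "complex_analytic_at f p" shows "complex_analytic_at (\<lambda>x. - f x) p"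
  using complex_analytic_at_compose[where G = "\<lambda>z. - z" and S = UNIV, OF assms] by (simp add: holomorphic_intros)

lemma complex_analytic_at_diff:
  assumes "complex_analytic_at f p" "complex_analytic_at g p"
  shows "complex_analytic_at (\<lambda>x. f x - g x) p"
  using complex_analytic_at_add[OF assms(1) complex_analytic_at_uminus[OF assms(2)]] by simp

lemma complex_analytic_at_coordinate: "complex_analytic_at (\<lambda>x. x $ j) p"
proof -
  have "complex_analytic_at (\<lambda>x. x $ j - p $ j) p"
    unfolding complex_analytic_at_def using majorized_at_shifted_coordinate zero_less_one by blast
  from complex_analytic_at_add[OF this complex_analytic_at_const[of "p $ j"]] show ?thesis by simp
qed

text \<open>On real points the monomials are real, so the real parts of the coefficients are the coefficients of the
  real part. The cube must be small enough to stay inside the set where \<open>f\<close> and \<open>F\<close> agree.\<close>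

lemma real_analytic_at_Re:
  fixes p :: "real ^ 'n"
  assumes "complex_analytic_at F (complex_point p)"
    and "open V" "p \<in> V" "\<And>x. x \<in> V \<Longrightarrow> f x = Re (F (complex_point x))"
  shows "real_analytic_at f p"
proof -
  obtain R M where R: "R > 0" "majorized_at (complex_point p) R M F"
    using assms(1) unfolding complex_analytic_at_def by blast
  then obtain a where a: "\<And>x. x \<in> polydisc (complex_point p) R \<Longrightarrow>
      ((\<lambda>\<alpha>. a \<alpha> * monomial_value \<alpha> (x - complex_point p)) has_sum F x) UNIV"
    unfolding majorized_at_def by blast
  obtain e where e: "e > 0" "ball p e \<subseteq> V" using assms open_contains_ball by blast
  define r where "r = min R (e / real CARD('n))"
  have r: "r > 0" "r \<le> R" using R e by (auto simp: r_def)
  have "((\<lambda>\<alpha>. Re (a \<alpha>) * (\<Prod>i\<in>UNIV. (x $ i - p $ i) ^ \<alpha> i)) has_sum f x) UNIV"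
    if x: "\<And>i. \<bar>x $ i - p $ i\<bar> < r" for x
  proof -
    have "norm (x - p) \<le> (\<Sum>i\<in>UNIV. \<bar>x $ i - p $ i\<bar>)" using norm_le_l1_cart[of "x - p"] by simp
    also have "\<dots> < (\<Sum>i\<in>(UNIV::'n set). r)" using x by (intro sum_strict_mono) auto
    also have "\<dots> \<le> e" using e by (simp add: r_def min_def field_simps)
    finally have "x \<in> V" using e by (auto simp: dist_norm norm_minus_commute)
    have "complex_point x \<in> polydisc (complex_point p) R"
      using x r
      by (auto simp: polydisc_def complex_point_def of_real_diff[symmetric] simp del: of_real_diff
          intro!: less_imp_le less_le_trans[OF x r(2)])
    from has_sum_Re[OF a[OF this]] show ?thesis
      unfolding assms(4)[OF \<open>x \<in> V\<close>]
      by (simp add: monomial_value_def complex_point_def of_real_diff[symmetric] of_real_power[symmetric]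
          of_real_prod[symmetric] del: of_real_diff of_real_power of_real_prod)
  qed
  then show ?thesis unfolding real_analytic_at_def using r
    by (intro exI[of _ r] conjI exI[of _ "\<lambda>\<alpha>. Re (a \<alpha>)"]) auto
qed

section \<open>Complex differentiability in several variables\<close>

definition complex_differentiable_at :: "(complex ^ 'n::finite \<Rightarrow> complex) \<Rightarrow> complex ^ 'n \<Rightarrow> bool" where
  "complex_differentiable_at f z \<longleftrightarrow>
     (\<exists>d :: complex ^ 'n. (f has_derivative (\<lambda>v. \<Sum>i\<in>UNIV. d $ i * v $ i)) (at z))"

lemma complex_differentiable_at_const: "complex_differentiable_at (\<lambda>_. c) z"
  unfolding complex_differentiable_at_def by (intro exI[of _ 0]) simp

lemma complex_differentiable_at_coordinate:
  fixes z :: "complex ^ 'n::finite"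
  shows "complex_differentiable_at (\<lambda>x. x $ j) z"
proof -
  have "(\<Sum>i\<in>UNIV. axis j 1 $ i * v $ i) = v $ j" for v :: "complex ^ 'n"
    by (simp add: axis_def if_distrib[of "\<lambda>x. x * _"] cong: if_cong)
  then show ?thesis unfolding complex_differentiable_at_def
    by (intro exI[of _ "axis j 1"])
       (auto intro: bounded_linear_imp_has_derivative bounded_linear_vec_nth)
qed

lemma complex_differentiable_at_add:
  assumes "complex_differentiable_at f z" "complex_differentiable_at g z"
  shows "complex_differentiable_at (\<lambda>x. f x + g x) z"
proof -
  obtain c d where "(f has_derivative (\<lambda>v. \<Sum>i\<in>UNIV. c $ i * v $ i)) (at z)"
    "(g has_derivative (\<lambda>v. \<Sum>i\<in>UNIV. d $ i * v $ i)) (at z)"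
    using assms unfolding complex_differentiable_at_def by blast
  from has_derivative_add[OF this] show ?thesis unfolding complex_differentiable_at_def
    by (intro exI[of _ "c + d"]) (simp add: distrib_right sum.distrib)
qed

lemma complex_differentiable_at_mult:
  assumes "complex_differentiable_at f z" "complex_differentiable_at g z"
  shows "complex_differentiable_at (\<lambda>x. f x * g x) z"
proof -
  obtain c d where "(f has_derivative (\<lambda>v. \<Sum>i\<in>UNIV. c $ i * v $ i)) (at z)"
    "(g has_derivative (\<lambda>v. \<Sum>i\<in>UNIV. d $ i * v $ i)) (at z)"
    using assms unfolding complex_differentiable_at_def by blast
  from has_derivative_mult[OF this] show ?thesis unfolding complex_differentiable_at_def
    by (intro exI[of _ "\<chi> i. f z * d $ i + c $ i * g z"])
       (simp add: distrib_left distrib_right sum.distrib sum_distrib_left sum_distrib_right mult_ac)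
qed

lemma complex_differentiable_at_compose:
  assumes "complex_differentiable_at f z" "G holomorphic_on S" "open S" "f z \<in> S"
  shows "complex_differentiable_at (\<lambda>x. G (f x)) z"
proof -
  obtain c where c: "(f has_derivative (\<lambda>v. \<Sum>i\<in>UNIV. c $ i * v $ i)) (at z)"
    using assms unfolding complex_differentiable_at_def by blast
  have "(G has_derivative (*) (deriv G (f z))) (at (f z))"
    using holomorphic_derivI[OF assms(2-4)] by (simp add: has_field_derivative_def)
  from has_derivative_compose[OF c this] show ?thesis unfolding complex_differentiable_at_def
    by (intro exI[of _ "\<chi> i. deriv G (f z) * c $ i"]) (simp add: sum_distrib_left mult_ac)
qed

lemma complex_differentiable_at_uminus:
  assumes "complex_differentiable_at f p" shows "complex_differentiable_at (\<lambda>x. - f x) p"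
  using complex_differentiable_at_compose[where G = "\<lambda>z. - z" and S = UNIV, OF assms] by (simp add: holomorphic_intros)

lemma complex_differentiable_at_diff:
  assumes "complex_differentiable_at f p" "complex_differentiable_at g p"
  shows "complex_differentiable_at (\<lambda>x. f x - g x) p"
  using complex_differentiable_at_add[OF assms(1) complex_differentiable_at_uminus[OF assms(2)]] by simp

section \<open>The map T across q = 0\<close>

definition exprel :: "complex \<Rightarrow> complex" where
  "exprel w = (if w = 0 then 1 else (exp w - 1) / w)"

definition lnrel :: "complex \<Rightarrow> complex" where
  "lnrel z = (if z = 0 then 1 else Ln (1 + z) / z)"

lemma holomorphic_exprel: "exprel holomorphic_on UNIV"
proof -
  have "deriv exp (0::complex) = 1" by (simp add: DERIV_imp_deriv[OF DERIV_exp])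
  then have "exprel = (\<lambda>z. if z = 0 then deriv exp 0 else (exp z - exp 0) / (z - 0))"
    by (auto simp: exprel_def)
  then show ?thesis
    using pole_lemma_open[of exp UNIV 0] by (simp add: holomorphic_on_exp)
qed

text \<open>The slit plane on which the principal branch of \<open>Ln (1 + z)\<close> is holomorphic.\<close>

definition lnrel_domain :: "complex set" where
  "lnrel_domain = {z. 1 + z \<notin> \<real>\<^sub>\<le>\<^sub>0}"

lemma open_lnrel_domain: "open lnrel_domain"
proof -
  have "lnrel_domain = (+) 1 -` (- \<real>\<^sub>\<le>\<^sub>0)" by (auto simp: lnrel_domain_def)
  moreover have "open ((+) 1 -` (- \<real>\<^sub>\<le>\<^sub>0 :: complex set))"
    by (intro open_vimage continuous_intros) auto
  ultimately show ?thesis by simp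
qed

lemma holomorphic_lnrel: "lnrel holomorphic_on lnrel_domain"
proof -
  have "((\<lambda>z. Ln (1 + z)) has_field_derivative 1) (at 0)"
    by (auto intro!: derivative_eq_intros)
  then have "deriv (\<lambda>z. Ln (1 + z)) 0 = 1" by (rule DERIV_imp_deriv)
  then have "lnrel = (\<lambda>z. if z = 0 then deriv (\<lambda>z. Ln (1 + z)) 0
      else (Ln (1 + z) - Ln (1 + 0)) / (z - 0))"
    by (auto simp: lnrel_def)
  moreover have "(\<lambda>z. Ln (1 + z)) holomorphic_on lnrel_domain"
    by (auto intro!: holomorphic_intros simp: lnrel_domain_def)
  note pole_lemma_open[OF this open_lnrel_domain, of 0]
  ultimately show ?thesis by (simp only:)
qed

text \<open>The number \<open>a = h / (1 + h)\<close>; as in \<open>T_joint\<close>, the coordinates 1, 2, 3, 4 are \<open>q\<close>, \<open>\<Lambda>\<close>, \<open>y\<close>, \<open>h\<close>.\<close>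

definition T_weight :: "complex ^ 4 \<Rightarrow> complex" where
  "T_weight z = z $ 4 * inverse (1 + z $ 4)"

text \<open>A logarithm of \<open>(y - h) / \<Lambda>\<close>.\<close>

definition T_log :: "complex ^ 4 \<Rightarrow> complex" where
  "T_log z = Ln (z $ 3 - z $ 4) - Ln (z $ 2)"

text \<open>For \<open>q \<noteq> 0\<close> the number \<open>1 + T_increment z\<close> is the reciprocal of the bracket in the definition of
  \<open>T\<close>.\<close>

definition T_increment :: "complex ^ 4 \<Rightarrow> complex" where
  "T_increment z = T_weight z * (exp (z $ 1 * T_log z) - 1)"

definition T_regular :: "complex ^ 4 \<Rightarrow> complex" where
  "T_regular z = (z $ 3 - z $ 4) *
     exp (- (T_weight z * T_log z * exprel (z $ 1 * T_log z) * lnrel (T_increment z)))"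

text \<open>The right half planes make the principal logarithm additive on the quotient \<open>(y - h) / \<Lambda>\<close>; the last
  condition keeps the bracket in the definition of \<open>T\<close> off the branch cut.\<close>

definition T_complex_domain :: "(complex ^ 4) set" where
  "T_complex_domain = {z. Re (z $ 2) > 0 \<and> Re (z $ 4) > 0 \<and> Re (z $ 3 - z $ 4) > 0
                         \<and> T_increment z \<in> lnrel_domain}"

text \<open>For \<open>q \<noteq> 0\<close> the exponent \<open>Ln (1 + I) / q\<close> becomes regular through \<open>Ln (1 + I) = I * lnrel I\<close> and
  \<open>exp (q * u) - 1 = q * u * exprel (q * u)\<close>, since \<open>I = a * (exp (q * u) - 1)\<close> carries the factor \<open>q\<close> that
  cancels. At \<open>q = 0\<close> both auxiliary functions have the value \<open>1\<close>.\<close>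

lemma T_joint_eq_T_regular:
  assumes "z \<in> T_complex_domain"
  shows "T_joint z = T_regular z"
proof -
  define q \<Lambda> y h where "q = z $ 1" "\<Lambda> = z $ 2" "y = z $ 3" "h = z $ 4"
  note defs = this
  have pos: "Re \<Lambda> > 0" "Re h > 0" "Re (y - h) > 0" and w: "1 + T_increment z \<notin> \<real>\<^sub>\<le>\<^sub>0"
    using assms by (auto simp: defs T_complex_domain_def lnrel_domain_def)
  have nz: "\<Lambda> \<noteq> 0" "y - h \<noteq> 0" "1 + h \<noteq> 0" using pos by (auto simp: complex_eq_iff)
  define u where "u = T_log z"
  have u: "u = Ln (y - h) - Ln \<Lambda>" by (simp add: u_def T_log_def defs)
  have Ln_div: "Ln ((y - h) / \<Lambda>) = u"
  proof -
    \<comment> \<open>Both arguments are below a right angle, so their difference is still principal.\<close>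
    have "\<bar>Im (Ln (y - h))\<bar> < pi / 2" "\<bar>Im (Ln \<Lambda>)\<bar> < pi / 2"
      using Re_Ln_pos_lt[of "y - h"] Re_Ln_pos_lt[of \<Lambda>] nz pos by auto
    then have "- pi < Im u" "Im u \<le> pi" unfolding u by auto
    moreover have "exp u = (y - h) / \<Lambda>" using nz by (simp add: u exp_diff)
    ultimately show ?thesis using Ln_unique by blast
  qed
  define a where "a = T_weight z"
  have a: "a = h / (1 + h)" by (simp add: a_def T_weight_def defs divide_inverse)
  define I where "I = T_increment z"
  have I: "I = a * (exp (q * u) - 1)" by (simp add: I_def T_increment_def a_def u_def defs)
  have R: "T_regular z = (y - h) * exp (- (a * u * exprel (q * u) * lnrel I))"
    by (simp add: T_regular_def a_def u_def I_def defs)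
  have J: "T_joint z = T_map h q \<Lambda> y" by (simp add: T_joint_def defs)
  show ?thesis
  proof (cases "q = 0")
    case True
    have "T_joint z = exp (1 / (1 + h) * Ln (y - h)) * exp (h / (1 + h) * Ln \<Lambda>)"
      using nz True by (simp add: J T_map_def powr_def)
    also have "1 / (1 + h) = 1 - a" using nz by (simp add: a field_simps)
    also have "exp ((1 - a) * Ln (y - h)) * exp (h / (1 + h) * Ln \<Lambda>) = exp (Ln (y - h)) * exp (- (a * u))"
      unfolding mult_exp_exp u a[symmetric] by (simp add: algebra_simps)
    also have "\<dots> = T_regular z" using nz True by (simp add: R I exprel_def lnrel_def)
    finally show ?thesis .
  next
    case False
    have E: "((y - h) / \<Lambda>) powr q = exp (q * u)" using nz by (simp add: powr_def Ln_div)
    have w': "1 + I \<notin> \<real>\<^sub>\<le>\<^sub>0" "1 + I \<noteq> 0" using w by (auto simp: I_def)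
    have "1 + h * exp (q * u) = (1 + I) * (1 + h)" using nz by (simp add: I a field_simps)
    then have "(1 + h) / (1 + h * exp (q * u)) = inverse (1 + I)"
      using nz w' by (simp add: divide_simps)
    then have "T_joint z = (y - h) * exp (- (Ln (1 + I) / q))"
      using False w' by (simp add: J T_map_def E) (simp add: powr_def Ln_inverse)
    also have "Ln (1 + I) / q = a * u * exprel (q * u) * lnrel I"
    proof -
      have "exprel (q * u) * (q * u) = exp (q * u) - 1" "lnrel I * I = Ln (1 + I)"
        by (auto simp: exprel_def lnrel_def)
      then have "Ln (1 + I) = lnrel I * (a * (exprel (q * u) * (q * u)))" using I by simp
      then show ?thesis using False by simp
    qed
    finally show ?thesis by (simp add: R)
  qed
qed

text \<open>For real arguments \<open>1 + T_increment z\<close> is a convex combination of \<open>1\<close> and a positive exponential, hence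
  positive.\<close>

lemma T_domain_subset_complex_domain:
  assumes "p \<in> T_domain"
  shows "complex_point p \<in> T_complex_domain"
proof -
  define h a u where "h = p $ 4" "a = h / (1 + h)" "u = ln (p $ 3 - p $ 4) - ln (p $ 2)"
  have pos: "p $ 2 > 0" "p $ 4 > 0" "p $ 3 - p $ 4 > 0" using assms by (auto simp: T_domain_def)
  have "0 < a" "a < 1" using pos by (auto simp: h_a_u_def)
  then have "0 < 1 - a + a * exp (p $ 1 * u)" by (simp add: add_pos_pos)
  then have w: "0 < 1 + a * (exp (p $ 1 * u) - 1)" by (simp add: algebra_simps)
  have "T_log (complex_point p) = of_real u"
    using pos by (simp add: T_log_def complex_point_def h_a_u_def Ln_of_real of_real_diff[symmetric]
        del: of_real_diff)
  moreover have "T_weight (complex_point p) = of_real a"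
    by (simp add: T_weight_def complex_point_def h_a_u_def divide_inverse)
  ultimately have "1 + T_increment (complex_point p) = of_real (1 + a * (exp (p $ 1 * u) - 1))"
    by (simp add: T_increment_def complex_point_def exp_of_real[symmetric])
  then have "1 + T_increment (complex_point p) \<notin> \<real>\<^sub>\<le>\<^sub>0"
    using w by (simp only: nonpos_Reals_of_real_iff)
  then show ?thesis using pos
    by (simp add: T_complex_domain_def lnrel_domain_def complex_point_def)
qed

lemma T_joint_complex_point:
  assumes "p \<in> T_domain"
  shows "T_joint (complex_point p) = complex_of_real (T_joint p)"
proof -
  have pos: "p $ 2 > 0" "p $ 4 > 0" "p $ 3 - p $ 4 > 0" using assms by (auto simp: T_domain_def)
  define h d where "h = p $ 4" "d = p $ 3 - p $ 4"
  have *: "complex_of_real (p $ 3) - complex_of_real (p $ 4) = of_real d"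
    by (simp add: h_d_def)
  show ?thesis
  proof (cases "p $ 1 = 0")
    case True
    have "of_real d powr (1 / (1 + complex_of_real h)) = of_real (d powr (1 / (1 + h)))"
         "of_real (p $ 2) powr (of_real h / (1 + complex_of_real h)) = of_real ((p $ 2) powr (h / (1 + h)))"
      using powr_of_real[of d "1 / (1 + h)"] powr_of_real[of "p $ 2" "h / (1 + h)"] pos
      by (auto simp: h_d_def)
    then show ?thesis using True
      by (simp add: T_joint_def T_map_def complex_point_def *) (simp add: h_d_def)
  next
    case False
    have 1: "(of_real d / of_real (p $ 2)) powr complex_of_real (p $ 1)
        = of_real ((d / p $ 2) powr (p $ 1))"
      using powr_of_real[of "d / p $ 2" "p $ 1"] pos by (auto simp: h_d_def)
    let ?B = "(1 + h) / (1 + h * (d / p $ 2) powr (p $ 1))"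
    have "0 \<le> ?B" using pos by (auto simp: h_d_def)
    then have 2: "of_real ?B powr (1 / complex_of_real (p $ 1)) = of_real (?B powr (1 / p $ 1))"
      using powr_of_real[of ?B "1 / p $ 1"] by simp
    show ?thesis using False 2
      by (simp add: T_joint_def T_map_def complex_point_def * 1) (simp add: h_d_def)
  qed
qed

lemma T_regular_parts_nonzero:
  fixes z :: "complex ^ 4"
  assumes "z \<in> T_complex_domain"
  shows "1 + z $ 4 \<noteq> 0" "z $ 2 \<notin> \<real>\<^sub>\<le>\<^sub>0" "z $ 3 - z $ 4 \<notin> \<real>\<^sub>\<le>\<^sub>0" "T_increment z \<in> lnrel_domain"
  using assms by (auto simp: T_complex_domain_def complex_eq_iff complex_nonpos_Reals_iff)

lemma complex_analytic_at_T_regular: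
  assumes z: "z \<in> T_complex_domain"
  shows "complex_analytic_at T_regular z"
proof -
  note I = complex_analytic_at_const complex_analytic_at_coordinate complex_analytic_at_add
    complex_analytic_at_diff complex_analytic_at_mult complex_analytic_at_uminus
  note nz = T_regular_parts_nonzero[OF z]
  note comp = complex_analytic_at_compose
  have w: "complex_analytic_at T_weight z"
    unfolding T_weight_def
    by (intro I comp[where G = inverse and S = "- {0}"]) (use nz in \<open>auto intro!: holomorphic_intros\<close>)
  have l: "complex_analytic_at T_log z"
    unfolding T_log_def
    by (intro I comp[where G = Ln and S = "- \<real>\<^sub>\<le>\<^sub>0"]) (use nz in \<open>auto intro!: holomorphic_intros\<close>)
  have i: "complex_analytic_at T_increment z"
    unfolding T_increment_def
    by (intro I w l comp[where G = exp and S = UNIV]) (auto intro!: holomorphic_intros)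
  have e: "complex_analytic_at (\<lambda>z. exprel (z $ 1 * T_log z)) z"
    by (intro I l comp[where G = exprel, OF _ holomorphic_exprel]) auto
  have n: "complex_analytic_at (\<lambda>z. lnrel (T_increment z)) z"
    by (rule comp[where f = T_increment and G = lnrel, OF i holomorphic_lnrel open_lnrel_domain nz(4)])
  show ?thesis
    unfolding T_regular_def
    by (intro I w l e n comp[where G = exp and S = UNIV]) (auto intro!: holomorphic_intros)
qed

lemma complex_differentiable_at_T_regular:
  assumes z: "z \<in> T_complex_domain"
  shows "complex_differentiable_at T_regular z"
proof -
  note I = complex_differentiable_at_const complex_differentiable_at_coordinate complex_differentiable_at_add
    complex_differentiable_at_diff complex_differentiable_at_mult complex_differentiable_at_uminus
  note nz = T_regular_parts_nonzero[OF z]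
  note comp = complex_differentiable_at_compose
  have w: "complex_differentiable_at T_weight z"
    unfolding T_weight_def
    by (intro I comp[where G = inverse and S = "- {0}"]) (use nz in \<open>auto intro!: holomorphic_intros\<close>)
  have l: "complex_differentiable_at T_log z"
    unfolding T_log_def
    by (intro I comp[where G = Ln and S = "- \<real>\<^sub>\<le>\<^sub>0"]) (use nz in \<open>auto intro!: holomorphic_intros\<close>)
  have i: "complex_differentiable_at T_increment z"
    unfolding T_increment_def
    by (intro I w l comp[where G = exp and S = UNIV]) (auto intro!: holomorphic_intros)
  have e: "complex_differentiable_at (\<lambda>z. exprel (z $ 1 * T_log z)) z"
    by (intro I l comp[where G = exprel, OF _ holomorphic_exprel]) auto
  have n: "complex_differentiable_at (\<lambda>z. lnrel (T_increment z)) z"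
    by (rule comp[where f = T_increment and G = lnrel, OF i holomorphic_lnrel open_lnrel_domain nz(4)])
  show ?thesis
    unfolding T_regular_def
    by (intro I w l e n comp[where G = exp and S = UNIV]) (auto intro!: holomorphic_intros)
qed

lemma open_T_complex_domain: "open T_complex_domain"
proof -
  define W where "W = {z :: complex ^ 4. Re (z $ 2) > 0 \<and> Re (z $ 4) > 0 \<and> Re (z $ 3 - z $ 4) > 0}"
  have "open W" unfolding W_def
    by (intro open_Collect_conj open_Collect_less continuous_intros)
  moreover have "continuous_on W T_increment"
    unfolding T_increment_def T_weight_def T_log_def
    by (intro continuous_intros) (auto simp: W_def complex_eq_iff complex_nonpos_Reals_iff)
  ultimately have "open (T_increment -` lnrel_domain \<inter> W)"
    using open_lnrel_domain continuous_on_open_vimage by blast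
  moreover have "T_complex_domain = T_increment -` lnrel_domain \<inter> W"
    by (auto simp: T_complex_domain_def W_def)
  ultimately show ?thesis by simp
qed

lemma jointly_holomorphic_T_joint: "jointly_holomorphic_on T_joint T_complex_domain"
  unfolding jointly_holomorphic_on_def
proof (intro conjI ballI open_T_complex_domain)
  fix z assume z: "z \<in> T_complex_domain"
  obtain d :: "complex ^ 4" where "(T_regular has_derivative (\<lambda>v. \<Sum>i\<in>UNIV. d $ i * v $ i)) (at z)"
    using complex_differentiable_at_T_regular[OF z] unfolding complex_differentiable_at_def by blast
  then have "(T_joint has_derivative (\<lambda>v. \<Sum>i\<in>UNIV. d $ i * v $ i)) (at z)"
    by (rule has_derivative_transform_within_open[OF _ open_T_complex_domain z])
       (simp add: T_joint_eq_T_regular)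
  then show "\<exists>d :: complex ^ 4. (T_joint has_derivative (\<lambda>v. \<Sum>i\<in>UNIV. d $ i * v $ i)) (at z)" by blast
qed

lemma real_analytic_at_T_joint:
  assumes "p \<in> T_domain"
  shows "real_analytic_at T_joint p"
proof (rule real_analytic_at_Re[OF complex_analytic_at_T_regular _ assms])
  show "complex_point p \<in> T_complex_domain" by (rule T_domain_subset_complex_domain[OF assms])
  show "open T_domain" unfolding T_domain_def
    by (intro open_Collect_conj open_Collect_less continuous_intros)
  fix x assume x: "x \<in> T_domain"
  show "T_joint x = Re (T_regular (complex_point x))"
    using T_joint_complex_point[OF x] T_joint_eq_T_regular[OF T_domain_subset_complex_domain[OF x]]
    by (metis Re_complex_of_real)
qed

section \<open>Maximizers, the orbit equation and analyticity\<close>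

theorem theorem1p1:
  fixes N :: nat and q t :: real
  assumes "N \<ge> 1" and "q > -1" and "t = q / (1 + q)"
  shows "((\<exists>!x. is_arg_max (hardy_ratio t N) (\<lambda>x. x \<in> open_simplex N) x)
          \<and> (\<exists>x\<in>positive_vectors N.
               {z. is_arg_max (hardy_ratio t N) (\<lambda>x. x \<in> positive_vectors N) z} = positive_ray N x))
       \<and> (\<forall>\<Lambda>. (\<Lambda> > 0 \<and> admissible_through N (T_orbit q \<Lambda>) \<and> real N * T_orbit q \<Lambda> N = 1)
               \<longleftrightarrow> \<Lambda> = hardy_lambda N q)
       \<and> ((\<forall>p\<in>T_domain. real_analytic_at T_joint p)
          \<and> (\<forall>p\<in>T_domain. T_joint (complex_point p) = complex_of_real (T_joint p))
          \<and> (\<forall>p\<in>T_domain. \<exists>U. complex_point p \<in> U \<and> jointly_holomorphic_on T_joint U))"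
proof -
  have t: "t < 1" using assms by simp
  obtain \<Lambda> where \<Lambda>: "\<Lambda> > 0" "real N * T_orbit q \<Lambda> N = 1" "admissible_through N (T_orbit q \<Lambda>)"
    using orbit_root_exists[OF assms(2,1)] by blast
  have x: "critical_vector N t \<Lambda> (orbit_vector N q \<Lambda> (T_orbit q \<Lambda>))"
    by (rule critical_vector_orbit_vector[OF assms(2,3) \<Lambda>(1,3,2)])
  then have xv: "orbit_vector N q \<Lambda> (T_orbit q \<Lambda>) \<in> positive_vectors N"
    by (simp add: critical_vector_def)
  have "\<Lambda>' > 0 \<and> admissible_through N (T_orbit q \<Lambda>') \<and> real N * T_orbit q \<Lambda>' N = 1
      \<longleftrightarrow> \<Lambda>' = hardy_lambda N q" for \<Lambda>'
    using hardy_lambda_eq_orbit_root[OF assms(1,2)] \<Lambda> by blast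
  then show ?thesis
    using unique_maximizer_open_simplex[OF assms(1) t x] maximizers_eq_positive_ray[OF assms(1) t x] xv
      real_analytic_at_T_joint T_joint_complex_point T_domain_subset_complex_domain
      jointly_holomorphic_T_joint
    by blast
qed

end
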